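(* Let $\rho>0$ and let $n_0\ge0$ be an integer. Let $N(t)$ be the Erlang A process with $\eta=1$ (the $M/M/\infty$ queue) and $N(0)=n_0$, let $p_n(t)=\mathrm{Prob}[N(t)=n\mid N(0)=n_0]$ and $\widehat P_n(\theta)=\int_0^\infty e^{-\theta t}p_n(t)\,dt$ for $\mathrm{Re}(\theta)>0$. Then $$\widehat P_n(\theta)=\frac{\Gamma(\theta)\,n_0!\,e^{-\rho}}{\rho^{n_0+\theta}}\begin{cases}F_{n_0}(\theta)\,G_n(\theta),& n\ge n_0\\ G_{n_0}(\theta)\,F_n(\theta),&0\le n\le n_0.\end{cases}$$ A spectral representation of $p_n(t)$ is $$p_n(t)=\frac{n_0!\,e^{-\rho}}{\rho^{n_0}}\sum_{k=0}^\infty\frac{\rho^k}{k!}e^{-kt}F_{n_0}(-k)F_n(-k),$$ where $$F_n(-k)=\frac1{2\pi i}\int_{C_0}\frac{(1-z)^k}{z^{n+1}}e^{\rho z}\,dz=\sum_{j=0}^{\min\{k,n\}}\binom kj(-1)^j\frac{\rho^{n-j}}{(n-j)!},$$ and an alternate form, for $t>0$, is $$p_n(t)=\rho^n(1-e^{-t})^n\exp\left[-\rho(1-e^{-t})\right]\sum_{j=0}^{\min\{n,n_0\}}\binom{n_0}{j}\rho^{-j}e^{-jt}(1-e^{-t})^{n_0-2j}\frac1{(n-j)!}.$$ Consequently $p_n(\infty)=\lim_{t\to\infty}p_n(t)=e^{-\rho}\rho^n/n!$.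
   Context: With service rate $\mu=1$ and $\eta=1$, $N(t)$ is the birth–death process on $\{0,1,2,\dots\}$ with birth rate $\rho$ in every state and death rate $n$ in state $n$. Special functions (for integer $n$): $$F_n(\theta)=\frac{1}{2\pi i}\int_{C_0}\frac{e^{\rho z}}{z^{n+1}(1-z)^\theta}\,dz,\qquad G_n(\theta)=\frac{1}{2\pi i}\int_{C_1}\frac{e^{\rho z}}{z^{n+1}(z-1)^\theta}\,dz,$$ where $C_0$ is a small counterclockwise circle about $0$ inside $|z|<1$; $C_1$ goes from $-\infty-i\varepsilon$ to $-\infty+i\varepsilon$ ($\varepsilon>0$), encircling $z=1$ counterclockwise and avoiding $\{\mathrm{Im}(z)=0,\mathrm{Re}(z)\le1\}$. Branches: $(1-z)^\theta=|1-z|^\theta e^{i\theta\arg(1-z)}$ with $|\arg(1-z)|<\pi$, and $(z-1)^\theta=|z-1|^\theta e^{i\theta\arg(z-1)}$ with $|\arg(z-1)|<\pi$. $F_n$ and $G_n$ are entire in $\theta$. *)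

theory Defs
  imports "HOL-Probability.Probability" "HOL-Complex_Analysis.Complex_Analysis"
begin

definition transition_function :: "(real \<Rightarrow> nat \<Rightarrow> nat \<Rightarrow> real) \<Rightarrow> bool" where
  "transition_function P \<longleftrightarrow>
     (\<forall>t\<ge>0. \<forall>i j. 0 \<le> P t i j) \<and>
     (\<forall>t\<ge>0. \<forall>i. (\<lambda>j. P t i j) sums 1) \<and>
     (\<forall>i j. P 0 i j = (if i = j then 1 else 0)) \<and>
     (\<forall>s\<ge>0. \<forall>t\<ge>0. \<forall>i j. (\<lambda>k. P s i k * P t k j) sums P (s + t) i j)"

text \<open>The death rate in state 0 is ignored.\<close>

definition bd_generator :: "(nat \<Rightarrow> real) \<Rightarrow> (nat \<Rightarrow> real) \<Rightarrow> nat \<Rightarrow> nat \<Rightarrow> real" where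
  "bd_generator birth death i j =
     (if j = i + 1 then birth i
      else if i = j + 1 then death i
      else if i = j then - (birth i + (if i = 0 then 0 else death i))
      else 0)"

text \<open>
  A time-homogeneous Markov process on the nonnegative integers, indexed by times \<open>t \<ge> 0\<close>, with
  arbitrary initial law. The derivative condition says that from state \<open>i\<close>, within time \<open>h\<close>, the
  process moves to \<open>i + 1\<close> with probability \<open>birth i * h + o(h)\<close>, to \<open>i - 1\<close> with
  probability \<open>death i * h + o(h)\<close>, and stays with the complementary probability up to \<open>o(h)\<close>.
  The last condition is the Markov property, given by the finite-dimensional distributions.
\<close>

definition birth_death_process ::
  "'w measure \<Rightarrow> (real \<Rightarrow> 'w \<Rightarrow> nat) \<Rightarrow> (nat \<Rightarrow> real) \<Rightarrow> (nat \<Rightarrow> real) \<Rightarrow> bool" where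
  "birth_death_process M N birth death \<longleftrightarrow>
     prob_space M \<and>
     (\<forall>t\<ge>0. N t \<in> measurable M (count_space UNIV)) \<and>
     (\<exists>P. transition_function P \<and>
        (\<forall>i j. ((\<lambda>h. P h i j) has_real_derivative bd_generator birth death i j)
                 (at 0 within {0..})) \<and>
        (\<forall>(m::nat) (ts :: nat \<Rightarrow> real) (xs :: nat \<Rightarrow> nat).
           ts 0 = 0 \<and> (\<forall>l<m. ts l \<le> ts (Suc l)) \<longrightarrow>
           measure M {\<omega> \<in> space M. \<forall>l\<le>m. N (ts l) \<omega> = xs l} =
             measure M {\<omega> \<in> space M. N 0 \<omega> = xs 0} *
             (\<Prod>l<m. P (ts (Suc l) - ts l) (xs l) (xs (Suc l)))))"

definition trans_prob :: "'w measure \<Rightarrow> (real \<Rightarrow> 'w \<Rightarrow> nat) \<Rightarrow> nat \<Rightarrow> nat \<Rightarrow> real \<Rightarrow> real" where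
  "trans_prob M N n0 n t = cond_prob M (\<lambda>\<omega>. N t \<omega> = n) (\<lambda>\<omega>. N 0 \<omega> = n0)"

text \<open>The function \<open>F\<^sub>n(\<theta>)\<close>, with \<open>C\<^sub>0\<close> the circle of radius \<open>r\<close>. Since \<open>z powr \<theta> = exp (\<theta> * Ln z)\<close>
  with the principal logarithm, \<open>powr\<close> is the branch with \<open>\<bar>arg\<bar> < \<pi>\<close> off the negative axis.\<close>

definition F_fun :: "real \<Rightarrow> real \<Rightarrow> nat \<Rightarrow> complex \<Rightarrow> complex" where
  "F_fun r \<rho> n \<theta> = 1 / (2 * of_real pi * \<i>) *
     contour_integral (circlepath 0 r)
       (\<lambda>z. exp (of_real \<rho> * z) / (z ^ (n + 1) * (1 - z) powr \<theta>))"

definition G_integrand :: "real \<Rightarrow> nat \<Rightarrow> complex \<Rightarrow> complex \<Rightarrow> complex" where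
  "G_integrand \<rho> n \<theta> z = exp (of_real \<rho> * z) / (z ^ (n + 1) * (z - 1) powr \<theta>)"

text \<open>
  The contour \<open>C\<^sub>1\<close> consists of the horizontal ray from \<open>-\<infinity> - \<i>\<epsilon>\<close> to the start of \<open>g\<close>, the path \<open>g\<close>,
  and the horizontal ray from the end of \<open>g\<close> to \<open>-\<infinity> + \<i>\<epsilon>\<close>. As \<open>g\<close> joins the line
  \<open>Im z = -\<epsilon>\<close> to the line \<open>Im z = \<epsilon>\<close> while avoiding the slit \<open>{z. Im z = 0 \<and> Re z \<le> 1}\<close>, it
  passes around 1 on the right, i.e. counterclockwise.
\<close>

definition hankel_middle :: "real \<Rightarrow> (real \<Rightarrow> complex) \<Rightarrow> bool" where
  "hankel_middle \<epsilon> g \<longleftrightarrow> \<epsilon> > 0 \<and> valid_path g \<and>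
     Im (pathstart g) = -\<epsilon> \<and> Im (pathfinish g) = \<epsilon> \<and>
     path_image g \<inter> {z. Im z = 0 \<and> Re z \<le> 1} = {}"

definition hankel_integral :: "real \<Rightarrow> (real \<Rightarrow> complex) \<Rightarrow> (complex \<Rightarrow> complex) \<Rightarrow> complex" where
  "hankel_integral \<epsilon> g f =
     (LINT x:{..Re (pathstart g)}|lborel. f (Complex x (-\<epsilon>)))
     + contour_integral g f
     - (LINT x:{..Re (pathfinish g)}|lborel. f (Complex x \<epsilon>))"

definition G_fun :: "real \<Rightarrow> (real \<Rightarrow> complex) \<Rightarrow> real \<Rightarrow> nat \<Rightarrow> complex \<Rightarrow> complex" where
  "G_fun \<epsilon> g \<rho> n \<theta> = 1 / (2 * of_real pi * \<i>) * hankel_integral \<epsilon> g (G_integrand \<rho> n \<theta>)"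

end

theory Submission
  imports Defs
begin

text \<open>
  The transition function solves the backward equation, and bounded solutions of that equation are
  unique by a maximum principle; hence \<open>N t\<close>, started from \<open>i\<close> customers, is distributed as
  \<open>Binomial(i, exp (- t)) + Poisson(\<rho> (1 - exp (- t)))\<close>. Both this law and the spectral series satisfy
  the same recursion in \<open>i\<close>, as \<open>F\<^sub>n(-k)\<close> is a Charlier polynomial.

  For the resolvent, the Laplace transforms of the explicit law and the products of \<open>F\<close> and \<open>G\<close>
  satisfy the same contiguity relations, which leaves the case \<open>i = n = 0\<close>. There both sides satisfy
  the same first-order difference equation in \<open>\<theta>\<close>, whose inhomogeneity for \<open>G\<close> is Hankel's integral for
  \<open>1 / Gamma\<close>, and their difference decays along \<open>\<theta> + M\<close>. All Hankel integrals are
  computed as limits of differences of a primitive on the two sides of the slit.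
\<close>

section \<open>Backward equation and uniqueness\<close>

text \<open>The assumption on the process fixes only the derivative of each entry of
  \<open>P\<close> at time 0, with no uniformity in the states, and the death rates are unbounded. A
  forward equation would need a limit inside the infinite Chapman sum, hence such uniformity. The
  backward equation does not: row \<open>i\<close> of the generator lives on the columns up to
  \<open>i + 1\<close> and sums to zero there, so the probability of being beyond these columns
  after time h is o(h) by conservation of mass alone. Unbounded rates then only cost a barrier that
  grows with the state. The contour integrals are handled for Re \<theta> \<ge> 0, where away from
  the real axis the integrand is dominated by a multiple of exp(\<rho> Re z). Convergence and
  independence of the contour follow from this bound alone. The relations for the product formula
  are proved for states n \<ge> n0; the remaining states come from the symmetry of the spectral
  series in its two states.\<close>

lemma sum_bd_generator:
  "(\<Sum>k\<le>Suc i. bd_generator b d i k) = 0"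
proof (cases i)
  case 0
  then show ?thesis by (simp add: bd_generator_def)
next
  case (Suc m)
  have "(\<Sum>k\<le>Suc i. bd_generator b d i k) = (\<Sum>k\<in>{m,i,Suc i}. bd_generator b d i k)"
    by (rule sum.mono_neutral_right) (auto simp: bd_generator_def Suc)
  then show ?thesis by (simp add: bd_generator_def Suc)
qed

lemma sum_bd_generator_mult:
  "(\<Sum>k\<le>Suc i. bd_generator b d i k * u k) =
     b i * (u (Suc i) - u i) + (if i = 0 then 0 else d i * (u (i - 1) - u i))"
proof (cases i)
  case 0
  then show ?thesis by (simp add: bd_generator_def algebra_simps)
next
  case (Suc m)
  have "(\<Sum>k\<le>Suc i. bd_generator b d i k * u k) =
        (\<Sum>k\<in>{m,i,Suc i}. bd_generator b d i k * u k)"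
    by (rule sum.mono_neutral_right) (auto simp: bd_generator_def Suc)
  then show ?thesis by (simp add: bd_generator_def Suc algebra_simps)
qed

section \<open>Transition functions: from the generator at time 0 to the backward equation\<close>

context
  fixes P :: "real \<Rightarrow> nat \<Rightarrow> nat \<Rightarrow> real"
  assumes tf: "transition_function P"
begin

lemma transition_nonneg: "t \<ge> 0 \<Longrightarrow> 0 \<le> P t i j"
  and transition_sums: "t \<ge> 0 \<Longrightarrow> (\<lambda>j. P t i j) sums 1"
  and transition_0: "P 0 i j = (if i = j then 1 else 0)"
  and transition_Chapman: "s \<ge> 0 \<Longrightarrow> t \<ge> 0 \<Longrightarrow> (\<lambda>k. P s i k * P t k j) sums P (s + t) i j"
  using tf unfolding transition_function_def by blast+

lemma transition_le_1:
  assumes "t \<ge> 0"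
  shows "P t i j \<le> 1"
  using sum_le_suminf[of "\<lambda>j. P t i j" "{j}"] transition_sums[OF assms, of i]
    transition_nonneg[OF assms, of i]
  by (simp add: sums_iff)

text \<open>By \<open>transition_Chapman\<close> the difference is the tail of the series over
  \<open>k > Suc i\<close>. Since 0 \<le> \<open>P s k j\<close> \<le> 1, it lies between 0 and the
  mass that row \<open>i\<close> of \<open>P h\<close> puts beyond \<open>Suc i\<close>.\<close>

lemma transition_step_bound:
  assumes "h \<ge> 0" "s \<ge> 0"
  shows "\<bar>P (h + s) i j - (\<Sum>k\<le>Suc i. P h i k * P s k j)\<bar> \<le> 1 - (\<Sum>k\<le>Suc i. P h i k)"
proof -
  let ?A = "{..Suc i}"
  have *: "(\<lambda>k. if k \<in> ?A then 0 else f k) sums (S - sum f ?A)" if "f sums S" for f :: "nat \<Rightarrow> real" and S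
  proof -
    have "(\<lambda>k. f k - (if k \<in> ?A then f k else 0)) sums (S - sum f ?A)"
      by (intro sums_diff that sums_If_finite_set) auto
    also have "(\<lambda>k. f k - (if k \<in> ?A then f k else 0)) = (\<lambda>k. if k \<in> ?A then 0 else f k)"
      by auto
    finally show ?thesis .
  qed
  note 1 = *[OF transition_Chapman[OF assms, of i j]] and 2 = *[OF transition_sums[OF assms(1), of i]]
  have "0 \<le> P (h + s) i j - (\<Sum>k\<le>Suc i. P h i k * P s k j)"
    by (rule sums_le[OF _ sums_zero 1]) (use assms transition_nonneg in auto)
  moreover have "P (h + s) i j - (\<Sum>k\<le>Suc i. P h i k * P s k j) \<le> 1 - (\<Sum>k\<le>Suc i. P h i k)"
    by (rule sums_le[OF _ 1 2])
      (use assms transition_nonneg transition_le_1 in \<open>auto intro!: mult_left_le\<close>)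
  ultimately show ?thesis by linarith
qed

context
  fixes b d :: "nat \<Rightarrow> real"
  assumes gen: "\<And>i j. ((\<lambda>h. P h i j) has_real_derivative bd_generator b d i j) (at 0 within {0..})"
begin

definition rate :: "real \<Rightarrow> nat \<Rightarrow> nat \<Rightarrow> real" where
  "rate h i k = (P h i k - (if i = k then 1 else 0)) / h"

lemma rate_tendsto: "((\<lambda>h. rate h i k) \<longlongrightarrow> bd_generator b d i k) (at_right 0)"
proof -
  have "((\<lambda>h. (P h i k - P 0 i k) / (h - 0)) \<longlongrightarrow> bd_generator b d i k) (at 0 within {0..})"
    using gen[of i k] by (simp add: has_field_derivative_iff)
  then show ?thesis
    unfolding rate_def transition_0 by (simp add: at_within_Ici_at_right)
qed

text \<open>This sum is minus the mass beyond \<open>Suc i\<close> divided by \<open>h\<close>, so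
  that mass is o(h); the generator row already sums to zero on the columns up to
  \<open>Suc i\<close>.\<close>

lemma rate_sum_tendsto: "((\<lambda>h. \<Sum>k\<le>Suc i. rate h i k) \<longlongrightarrow> 0) (at_right 0)"
proof -
  have "((\<lambda>h. \<Sum>k\<le>Suc i. rate h i k) \<longlongrightarrow> (\<Sum>k\<le>Suc i. bd_generator b d i k)) (at_right 0)"
    by (intro tendsto_sum rate_tendsto)
  then show ?thesis by (simp only: sum_bd_generator)
qed

text \<open>This is \<open>transition_step_bound\<close> divided by \<open>h\<close>. The right-hand
  side does not involve \<open>s\<close>, which lets the base point move with
  \<open>h\<close>.\<close>

lemma difference_quotient_bound:
  assumes "h > 0" "s \<ge> 0"
  shows "\<bar>(P (s + h) i j - P s i j) / h - (\<Sum>k\<le>Suc i. rate h i k * P s k j)\<bar> \<le> \<bar>\<Sum>k\<le>Suc i. rate h i k\<bar>"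
proof -
  have 1: "(\<Sum>k\<le>Suc i. P h i k * P s k j) = P s i j + h * (\<Sum>k\<le>Suc i. rate h i k * P s k j)"
  proof -
    have "(\<Sum>k\<le>Suc i. P h i k * P s k j) =
          (\<Sum>k\<le>Suc i. (if i = k then P s k j else 0) + h * (rate h i k * P s k j))"
      by (rule sum.cong) (use assms in \<open>auto simp: rate_def field_simps\<close>)
    also have "\<dots> = P s i j + h * (\<Sum>k\<le>Suc i. rate h i k * P s k j)"
      unfolding sum.distrib sum_distrib_left[symmetric] by simp
    finally show ?thesis .
  qed
  have 2: "(\<Sum>k\<le>Suc i. P h i k) = 1 + h * (\<Sum>k\<le>Suc i. rate h i k)"
  proof -
    have "(\<Sum>k\<le>Suc i. P h i k) = (\<Sum>k\<le>Suc i. (if i = k then 1 else 0) + h * rate h i k)"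
      by (rule sum.cong) (use assms in \<open>auto simp: rate_def field_simps\<close>)
    also have "\<dots> = 1 + h * (\<Sum>k\<le>Suc i. rate h i k)"
      unfolding sum.distrib sum_distrib_left[symmetric] by simp
    finally show ?thesis .
  qed
  define a where "a = (\<Sum>k\<le>Suc i. rate h i k * P s k j)"
  define c where "c = (\<Sum>k\<le>Suc i. rate h i k)"
  have "\<bar>P (s + h) i j - P s i j - h * a\<bar> \<le> h * (- c)"
    using transition_step_bound[of h s i j, unfolded 1 2] assms unfolding a_def[symmetric] c_def[symmetric]
    by (simp add: add.commute diff_diff_eq)
  also have "\<dots> \<le> h * \<bar>c\<bar>" using assms by (intro mult_left_mono) auto
  finally have "\<bar>P (s + h) i j - P s i j - h * a\<bar> \<le> h * \<bar>c\<bar>" .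
  moreover have "(P (s + h) i j - P s i j) / h - a = (P (s + h) i j - P s i j - h * a) / h"
    using assms by (simp add: field_simps)
  ultimately show ?thesis using assms unfolding a_def[symmetric] c_def[symmetric]
    by (simp add: abs_divide pos_divide_le_eq mult.commute)
qed

text \<open>\<open>m\<close> is a modulus of continuity independent of the base point. The forward
  estimate from \<open>s\<close> to \<open>s + h\<close> therefore suffices: for
  \<open>x < t\<close> it is started at \<open>x\<close>.\<close>

lemma transition_continuous: "continuous_on {0..} (\<lambda>t. P t i j)"
proof -
  define m where "m h = h * ((\<Sum>k\<le>Suc i. \<bar>rate h i k\<bar>) + \<bar>\<Sum>k\<le>Suc i. rate h i k\<bar>)" for h
  have m: "(m \<longlongrightarrow> 0) (at_right 0)"
  proof -
    have "(m \<longlongrightarrow> 0 * ((\<Sum>k\<le>Suc i. \<bar>bd_generator b d i k\<bar>) + \<bar>0\<bar>)) (at_right 0)"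
      unfolding m_def by (intro tendsto_intros rate_tendsto rate_sum_tendsto)
    then show ?thesis by simp
  qed
  have le: "\<bar>P (s + h) i j - P s i j\<bar> \<le> m h" if "h > 0" "s \<ge> 0" for s h
  proof -
    have "\<bar>\<Sum>k\<le>Suc i. rate h i k * P s k j\<bar> \<le> (\<Sum>k\<le>Suc i. \<bar>rate h i k\<bar>)"
      by (rule order_trans[OF sum_abs], rule sum_mono)
        (use that transition_nonneg transition_le_1 in \<open>auto simp: abs_mult intro!: mult_left_le\<close>)
    then have "\<bar>(P (s + h) i j - P s i j) / h\<bar> \<le> (\<Sum>k\<le>Suc i. \<bar>rate h i k\<bar>) + \<bar>\<Sum>k\<le>Suc i. rate h i k\<bar>"
      using difference_quotient_bound[OF that, of i j] by linarith
    then show ?thesis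
      using that unfolding m_def by (simp add: abs_divide pos_divide_le_eq mult.commute)
  qed
  show ?thesis
    unfolding continuous_on_iff
  proof (intro ballI allI impI)
    fix t e :: real assume t: "t \<in> {0..}" and e: "e > 0"
    obtain \<delta> where \<delta>: "\<delta> > 0" "\<And>h. 0 < h \<Longrightarrow> h < \<delta> \<Longrightarrow> \<bar>m h\<bar> < e"
      using m e unfolding tendsto_iff eventually_at_right_field by fastforce
    have "dist (P x i j) (P t i j) < e" if "x \<in> {0..}" "dist x t < \<delta>" for x
    proof -
      consider "x = t" | "x > t" | "x < t" by linarith
      then show ?thesis
      proof cases
        case 2
        then show ?thesis using le[of "x - t" t] \<delta>(2)[of "x - t"] that t
          by (auto simp: dist_real_def)
      next
        case 3
        then show ?thesis using le[of "t - x" x] \<delta>(2)[of "t - x"] that t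
          by (auto simp: dist_real_def)
      qed (use e in auto)
    qed
    then show "\<exists>d>0. \<forall>x\<in>{0..}. dist x t < d \<longrightarrow> dist (P x i j) (P t i j) < e"
      using \<delta>(1) by blast
  qed
qed

text \<open>The error in the difference quotient is uniform in time, so the left derivative exists together
  with the right one.\<close>

lemma backward_equation:
  assumes t: "t > 0"
  shows "((\<lambda>s. P s i j) has_real_derivative
          b i * (P t (Suc i) j - P t i j) + (if i = 0 then 0 else d i * (P t (i - 1) j - P t i j))) (at t)"
proof -
  let ?D = "\<Sum>k\<le>Suc i. bd_generator b d i k * P t k j"
  \<comment> \<open>The base point \<open>f h\<close> may move: the constant \<open>t\<close> gives
    the right derivative, \<open>t - h\<close> the left one.\<close>
  have lim: "((\<lambda>h. (P (f h + h) i j - P (f h) i j) / h) \<longlongrightarrow> ?D) (at_right 0)"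
    if f: "(f \<longlongrightarrow> t) (at_right 0)" "\<forall>\<^sub>F h in at_right 0. f h \<ge> 0" for f :: "real \<Rightarrow> real"
  proof -
    have *: "((\<lambda>h. P (f h) k j) \<longlongrightarrow> P t k j) (at_right 0)" for k
      by (rule continuous_on_tendsto_compose[OF transition_continuous f(1)]) (use f t in auto)
    have 1: "((\<lambda>h. \<Sum>k\<le>Suc i. rate h i k * P (f h) k j) \<longlongrightarrow> ?D) (at_right 0)"
      by (intro tendsto_intros rate_tendsto *)
    have "((\<lambda>h. (P (f h + h) i j - P (f h) i j) / h - (\<Sum>k\<le>Suc i. rate h i k * P (f h) k j)) \<longlongrightarrow> 0) (at_right 0)"
    proof (rule Lim_null_comparison)
      show "\<forall>\<^sub>F h in at_right 0. norm ((P (f h + h) i j - P (f h) i j) / h - (\<Sum>k\<le>Suc i. rate h i k * P (f h) k j))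
            \<le> \<bar>\<Sum>k\<le>Suc i. rate h i k\<bar>"
        using f(2) eventually_at_right_less[of 0]
        by eventually_elim (use difference_quotient_bound in auto)
      show "((\<lambda>h. \<bar>\<Sum>k\<le>Suc i. rate h i k\<bar>) \<longlongrightarrow> 0) (at_right 0)"
        using tendsto_rabs[OF rate_sum_tendsto[of i]] by simp
    qed
    from tendsto_add[OF this 1] show ?thesis by simp
  qed
  have R: "((\<lambda>h. (P (t + h) i j - P t i j) / h) \<longlongrightarrow> ?D) (at_right 0)"
    by (rule lim) (use t in auto)
  have "((\<lambda>h. (P ((t - h) + h) i j - P (t - h) i j) / h) \<longlongrightarrow> ?D) (at_right 0)"
  proof (rule lim)
    show "((\<lambda>h. t - h) \<longlongrightarrow> t) (at_right 0)" by (auto intro!: tendsto_eq_intros)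
    show "\<forall>\<^sub>F h in at_right 0. 0 \<le> t - h"
      unfolding eventually_at_right_field by (rule exI[of _ t]) (use t in auto)
  qed
  moreover have "(P (t + - h) i j - P t i j) / - h = (P ((t - h) + h) i j - P (t - h) i j) / h" for h
    by (simp add: diff_divide_distrib)
  ultimately have L: "((\<lambda>h. (P (t + h) i j - P t i j) / h) \<longlongrightarrow> ?D) (at_left 0)"
    by (simp add: filterlim_at_left_to_right[where a = 0])
  have "((\<lambda>h. (P (t + h) i j - P t i j) / h) \<longlongrightarrow> ?D) (at 0)"
    using L R by (simp add: filterlim_split_at)
  then have "((\<lambda>s. P s i j) has_real_derivative ?D) (at t)"
    by (simp add: DERIV_def)
  then show ?thesis by (simp only: sum_bd_generator_mult)
qed

end

end

text \<open>Maximum principle: \<open>i + 1 + 2\<rho>t\<close> is a strict supersolution tending to infinity with \<open>i\<close>, so that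
  \<open>w\<close> minus a small multiple of it would attain a positive maximum.\<close>

lemma backward_equation_le_0:
  fixes w :: "real \<Rightarrow> nat \<Rightarrow> real"
  assumes \<rho>: "\<rho> > 0"
    and init: "\<And>i. w 0 i = 0"
    and bounded: "\<And>t i. t \<ge> 0 \<Longrightarrow> w t i \<le> B"
    and cont: "\<And>i. continuous_on {0..} (\<lambda>t. w t i)"
    and deriv: "\<And>t i. t > 0 \<Longrightarrow> ((\<lambda>s. w s i) has_real_derivative
        \<rho> * (w t (Suc i) - w t i) + (if i = 0 then 0 else real i * (w t (i - 1) - w t i))) (at t)"
    and T: "T \<ge> 0"
  shows "w T i \<le> 0"
proof (rule ccontr)
  assume "\<not> w T i \<le> 0"
  then have pos: "w T i > 0" by simp
  \<comment> \<open>Chosen so that \<open>\<phi> T i\<close> is half of \<open>w T i\<close>, hence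
    positive.\<close>
  define \<delta> where "\<delta> = w T i / (2 * (real i + 1 + 2 * \<rho> * T))"
  have den: "real i + 1 + 2 * \<rho> * T > 0" using \<rho> T by (simp add: add_nonneg_pos add_pos_nonneg)
  have \<delta>: "\<delta> > 0" using pos den by (simp add: \<delta>_def)
  define \<phi> where "\<phi> s k = w s k - \<delta> * (real k + 1 + 2 * \<rho> * s)" for s k
  have "\<phi> T i = w T i / 2"
    using den unfolding \<phi>_def \<delta>_def by (simp add: field_simps)
  then have \<phi>pos: "\<phi> T i > 0" using pos by simp
  obtain K where K: "B < real K * \<delta>" using reals_Archimedean3[OF \<delta>] by blast
  \<comment> \<open>The growth of the barrier makes \<open>\<phi>\<close> nonpositive from
    \<open>K\<close> on, so a positive supremum over all states is a maximum over finitely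
    many.\<close>
  have big: "\<phi> s k \<le> 0" if "s \<ge> 0" "k \<ge> K" for s k
  proof -
    have "w s k \<le> B" using bounded that by simp
    also have "\<dots> \<le> real k * \<delta>" using K that \<delta>
      by (meson less_eq_real_def mult_right_mono of_nat_le_iff order_trans)
    also have "\<dots> \<le> \<delta> * (real k + 1 + 2 * \<rho> * s)"
      using \<delta> \<rho> that by (simp add: algebra_simps)
    finally show ?thesis by (simp add: \<phi>_def)
  qed
  have "\<exists>s\<in>{0..T}. \<forall>s'\<in>{0..T}. \<phi> s' k \<le> \<phi> s k" for k
  proof (rule continuous_attains_sup)
    show "continuous_on {0..T} (\<lambda>s. \<phi> s k)"
      unfolding \<phi>_def by (intro continuous_intros continuous_on_subset[OF cont]) auto
  qed (use T in auto)
  then obtain S where S: "\<And>k. S k \<in> {0..T}" "\<And>k s. s \<in> {0..T} \<Longrightarrow> \<phi> s k \<le> \<phi> (S k) k"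
    by metis
  have iK: "i < K" using big[of T i] T \<phi>pos by (meson linorder_not_less)
  define m where "m = Max ((\<lambda>k. \<phi> (S k) k) ` {..<K})"
  have "m \<in> (\<lambda>k. \<phi> (S k) k) ` {..<K}"
    unfolding m_def by (rule Max_in) (use iK in auto)
  then obtain l where l: "l < K" "m = \<phi> (S l) l" by auto
  have max: "\<phi> s k \<le> \<phi> (S l) l" if "k < K" "s \<in> {0..T}" for s k
  proof -
    have "\<phi> s k \<le> \<phi> (S k) k" using S that by blast
    also have "\<dots> \<le> m" unfolding m_def by (rule Max_ge) (use that in auto)
    finally show ?thesis using l by simp
  qed
  define t where "t = S l"
  have tT: "t \<in> {0..T}" using S by (simp add: t_def)
  have mpos: "\<phi> t l > 0" using max[OF iK, of T] T \<phi>pos by (simp add: t_def)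
  have max': "\<phi> s k \<le> \<phi> t l" if "s \<in> {0..T}" for s k
    using max[of k s] big[of s k] that mpos by (cases "k < K") (auto simp: t_def)
  have "\<phi> 0 l < 0" using \<delta> by (simp add: \<phi>_def init)
  then have t0: "t > 0" using tT mpos by (cases "t = 0") auto
  define D where "D = \<rho> * (w t (Suc l) - w t l) + (if l = 0 then 0 else real l * (w t (l - 1) - w t l)) - \<delta> * (2 * \<rho>)"
  have der: "((\<lambda>s. \<phi> s l) has_real_derivative D) (at t)"
    unfolding \<phi>_def D_def by (auto intro!: derivative_eq_intros deriv[OF t0])
  \<comment> \<open>At the maximum the birth term is at most \<rho>\<delta> and the death term at
    most 0, while the barrier subtracts 2\<rho>\<delta>. The factor 2 in the barrier is what leaves
    a strictly negative slope.\<close>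
  have "\<rho> * (w t (Suc l) - w t l) \<le> \<rho> * \<delta>"
    using max'[of t "Suc l"] tT \<rho> by (intro mult_left_mono) (auto simp: \<phi>_def algebra_simps)
  moreover have "(if l = 0 then 0 else real l * (w t (l - 1) - w t l)) \<le> 0"
    using max'[of t "l - 1"] tT \<delta>
    by (auto simp: \<phi>_def algebra_simps of_nat_diff intro!: mult_nonneg_nonpos)
  moreover have "\<delta> * (2 * \<rho>) = 2 * (\<rho> * \<delta>)" by simp
  ultimately have "D \<le> - (\<rho> * \<delta>)" unfolding D_def by linarith
  then have "D < 0" using mult_pos_pos[OF \<rho> \<delta>] by simp
  \<comment> \<open>Only earlier times are compared, because \<open>t\<close> may equal
    \<open>T\<close>.\<close>
  from DERIV_neg_dec_left[OF der this] obtain e where e: "e > 0" "\<And>h. 0 < h \<Longrightarrow> h < e \<Longrightarrow> \<phi> t l < \<phi> (t - h) l"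
    by auto
  define h where "h = min (e / 2) t"
  have "\<phi> t l < \<phi> (t - h) l" using e t0 by (intro e) (auto simp: h_def)
  moreover have "\<phi> (t - h) l \<le> \<phi> t l" by (rule max') (use tT t0 e in \<open>auto simp: h_def\<close>)
  ultimately show False by simp
qed

section \<open>Transition probabilities of the infinite-server queue\<close>

text \<open>\<open>mm_inf \<rho> x i n\<close> is the probability that \<open>Binomial(i, x) + Poisson(\<rho> (1 - x))\<close>, a sum of
  independent variables, equals \<open>n\<close>; for \<open>x = exp (- t)\<close> this is the law of the queue at time \<open>t\<close>
  started with \<open>i\<close> customers. The recursion removes one of the initial customers.\<close>

primrec mm_inf :: "real \<Rightarrow> real \<Rightarrow> nat \<Rightarrow> nat \<Rightarrow> real" where
  "mm_inf \<rho> x 0 n = (\<rho> * (1 - x)) ^ n / fact n * exp (- \<rho> * (1 - x))"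
| "mm_inf \<rho> x (Suc i) n =
     (1 - x) * mm_inf \<rho> x i n + x * (case n of 0 \<Rightarrow> 0 | Suc m \<Rightarrow> mm_inf \<rho> x i m)"

lemma power_div_fact_le_exp:
  fixes y :: real
  assumes "y \<ge> 0"
  shows "y ^ n / fact n \<le> exp y"
proof -
  have "(\<Sum>k\<in>{n}. y ^ k / fact k) \<le> (\<Sum>k. y ^ k / fact k)"
    by (rule sum_le_suminf) (use assms summable_exp_generic[of y] in \<open>auto simp: field_simps\<close>)
  also have "\<dots> = exp y"
    by (simp add: exp_def field_simps)
  finally show ?thesis by simp
qed

lemma mm_inf_bounds:
  assumes "\<rho> \<ge> 0" "0 \<le> x" "x \<le> 1"
  shows "0 \<le> mm_inf \<rho> x i n \<and> mm_inf \<rho> x i n \<le> 1"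
proof (induction i arbitrary: n)
  case 0
  have "(\<rho> * (1 - x)) ^ n / fact n * exp (- (\<rho> * (1 - x)))
        \<le> exp (\<rho> * (1 - x)) * exp (- (\<rho> * (1 - x)))"
    by (intro mult_right_mono power_div_fact_le_exp) (use assms in auto)
  also have "\<dots> = 1" by (simp flip: exp_add)
  finally show ?case using assms by simp
next
  case (Suc i)
  define y where "y = (case n of 0 \<Rightarrow> 0 | Suc m \<Rightarrow> mm_inf \<rho> x i m)"
  have y: "0 \<le> y" "y \<le> 1" unfolding y_def using Suc by (auto split: nat.split)
  have "(1 - x) * mm_inf \<rho> x i n + x * y \<le> (1 - x) * 1 + x * 1"
    by (intro add_mono mult_left_mono) (use y Suc assms in auto)
  then show ?case using y Suc assms by (auto simp flip: y_def)
qed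

lemma mm_inf_1: "mm_inf \<rho> 1 i n = (if i = n then 1 else 0)"
  by (induction i arbitrary: n) (auto split: nat.split simp: power_0_left)

text \<open>The value \<open>x = 0\<close> stands for infinite time: no initial customer is
  left.\<close>

lemma mm_inf_0: "mm_inf \<rho> 0 i n = exp (- \<rho>) * \<rho> ^ n / fact n"
  by (induction i) auto

lemma continuous_mm_inf [continuous_intros]:
  fixes f :: "'a::topological_space \<Rightarrow> real"
  assumes "continuous_on S f"
  shows "continuous_on S (\<lambda>t. mm_inf \<rho> (f t) i n)"
proof (induction i arbitrary: n)
  case 0
  then show ?case by (auto intro!: continuous_intros assms)
next
  case (Suc i)
  then show ?case by (cases n) (auto intro!: continuous_intros assms)
qed

text \<open>Induction on \<open>i\<close>, differentiating the recursion by the product rule. At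
  \<open>i = 0\<close> the Poisson mean \<rho>(1 - exp(-t)) has derivative \<rho> exp(-t), and the
  derivative of a Poisson weight in its mean is a difference of two consecutive weights.\<close>

lemma mm_inf_backward_equation:
  "((\<lambda>t. mm_inf \<rho> (exp (- t)) i n) has_real_derivative
      \<rho> * (mm_inf \<rho> (exp (- t)) (Suc i) n - mm_inf \<rho> (exp (- t)) i n)
      + (if i = 0 then 0 else real i * (mm_inf \<rho> (exp (- t)) (i - 1) n - mm_inf \<rho> (exp (- t)) i n))) (at t)"
proof (induction i arbitrary: n)
  case 0
  define y where "y = \<rho> * (1 - exp (- t))"
  show ?case
  proof (cases n)
    case 0
    then show ?thesis
      by (auto intro!: derivative_eq_intros simp: algebra_simps)
  next
    case (Suc m)
    have "((\<lambda>t. (\<rho> * (1 - exp (- t))) ^ Suc m / fact (Suc m)) has_real_derivative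
           \<rho> * exp (- t) * (y ^ m / fact m)) (at t)"
      unfolding y_def
      by (auto intro!: derivative_eq_intros simp: field_simps simp del: power_Suc of_nat_Suc)
    moreover have "((\<lambda>t. exp (- \<rho> * (1 - exp (- t)))) has_real_derivative
           - (\<rho> * exp (- t) * exp (- y))) (at t)"
      unfolding y_def by (auto intro!: derivative_eq_intros)
    ultimately have "((\<lambda>t. (\<rho> * (1 - exp (- t))) ^ Suc m / fact (Suc m) * exp (- \<rho> * (1 - exp (- t))))
       has_real_derivative
       \<rho> * exp (- t) * (y ^ m / fact m) * exp (- y)
       + - (\<rho> * exp (- t) * exp (- y)) * (y ^ Suc m / fact (Suc m))) (at t)"
      by (intro DERIV_mult'[THEN DERIV_cong]) (auto simp: y_def)
    moreover have "\<rho> * (mm_inf \<rho> (exp (- t)) (Suc 0) n - mm_inf \<rho> (exp (- t)) 0 n) =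
       \<rho> * exp (- t) * (y ^ m / fact m) * exp (- y)
       + - (\<rho> * exp (- t) * exp (- y)) * (y ^ Suc m / fact (Suc m))"
    proof -
      have v: "mm_inf \<rho> (exp (- t)) 0 k = y ^ k / fact k * exp (- y)" for k
        by (simp add: y_def)
      show ?thesis
        unfolding Suc mm_inf.simps(2) nat.case v by (simp add: algebra_simps add_divide_distrib diff_divide_distrib del: power_Suc fact_Suc)
    qed
    ultimately show ?thesis unfolding Suc by simp
  qed
next
  case (Suc i)
  define x where "x = exp (- t)"
  define q where "q = mm_inf \<rho> x"
  define D where "D i n = \<rho> * (q (Suc i) n - q i n) + (if i = 0 then 0 else real i * (q (i - 1) n - q i n))" for i n
  have IH: "((\<lambda>t. mm_inf \<rho> (exp (- t)) i n) has_real_derivative D i n) (at t)" for n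
    using Suc[of n] by (simp only: D_def q_def x_def)
  have dx: "((\<lambda>t. exp (- t)) has_real_derivative - x) (at t)" "((\<lambda>t. 1 - exp (- t)) has_real_derivative x) (at t)"
    unfolding x_def by (auto intro!: derivative_eq_intros)
  show ?case
  proof (cases n)
    case 0
    have "((\<lambda>t. (1 - exp (- t)) * mm_inf \<rho> (exp (- t)) i 0) has_real_derivative
          x * q i 0 + D i 0 * (1 - x)) (at t)"
      using DERIV_mult[OF dx(2) IH[of 0]] by (simp add: q_def x_def)
    moreover have "x * q i 0 + D i 0 * (1 - x) = D (Suc i) 0"
      by (cases i) (simp_all add: D_def q_def algebra_simps)
    ultimately show ?thesis by (simp add: 0 D_def q_def flip: x_def)
  next
    case (Suc m)
    have "((\<lambda>t. (1 - exp (- t)) * mm_inf \<rho> (exp (- t)) i n + exp (- t) * mm_inf \<rho> (exp (- t)) i m) has_real_derivative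
          (x * q i n + D i n * (1 - x)) + (- x * q i m + D i m * x)) (at t)"
      using DERIV_add[OF DERIV_mult[OF dx(2) IH[of n]] DERIV_mult[OF dx(1) IH[of m]]]
      by (simp add: q_def x_def)
    moreover have "(x * q i n + D i n * (1 - x)) + (- x * q i m + D i m * x) = D (Suc i) n"
    proof (cases i)
      case 0
      then show ?thesis by (cases m) (simp_all add: D_def q_def Suc algebra_simps del: mm_inf.simps(1))
    next
      case (Suc k)
      have *: "q (Suc l) n = (1 - x) * q l n + x * q l m" for l
        by (simp add: q_def \<open>n = Suc m\<close>)
      \<comment> \<open>Needs the recursion at three consecutive numbers of customers; over free
        reals it is a polynomial consequence of these three instances.\<close>
      have alg: "x * qn + (\<rho> * (An - qn) + c * (kn - qn)) * (1 - x)
          + (- x * qm + (\<rho> * (Am - qm) + c * (km - qm)) * x) = \<rho> * (B - An) + (c + 1) * (qn - An)"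
        if "B = (1 - x) * An + x * Am" "An = (1 - x) * qn + x * qm" "qn = (1 - x) * kn + x * km"
        for qn An c kn qm Am km B :: real
        using that by algebra
      show ?thesis
        using alg[OF *[of "Suc i"] *[of i] *[of k, folded Suc], of "real i"] Suc by (simp add: D_def add.commute)
    qed
    ultimately show ?thesis by (simp add: Suc D_def q_def flip: x_def)
  qed
qed

text \<open>The convolution of binomial and Poisson weights; Pascal's rule accounts for one more
  customer. For \<open>j > i\<close> the binomial coefficient vanishes, so the truncated
  \<open>i - j\<close> does no harm.\<close>

lemma mm_inf_sum:
  "mm_inf \<rho> x i n = (\<Sum>j\<le>n. real (i choose j) * x ^ j * (1 - x) ^ (i - j) *
     ((\<rho> * (1 - x)) ^ (n - j) / fact (n - j) * exp (- \<rho> * (1 - x))))"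
proof (induction i arbitrary: n)
  case 0
  have "(\<Sum>j\<le>n. real (0 choose j) * x ^ j * (1 - x) ^ (0 - j) *
     ((\<rho> * (1 - x)) ^ (n - j) / fact (n - j) * exp (- \<rho> * (1 - x)))) =
     (\<Sum>j\<in>{0}. real (0 choose j) * x ^ j * (1 - x) ^ (0 - j) *
     ((\<rho> * (1 - x)) ^ (n - j) / fact (n - j) * exp (- \<rho> * (1 - x))))"
    by (rule sum.mono_neutral_right) auto
  then show ?case by simp
next
  case (Suc i)
  define p where "p m = (\<rho> * (1 - x)) ^ m / fact m * exp (- \<rho> * (1 - x))" for m
  define a where "a i j = real (i choose j) * x ^ j * (1 - x) ^ (i - j)" for i j
  have IH: "mm_inf \<rho> x i k = (\<Sum>j\<le>k. a i j * p (k - j))" for k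
    using Suc[of k] by (simp only: a_def p_def)
  have a0: "a (Suc i) 0 = (1 - x) * a i 0" by (simp add: a_def)
  have aS: "a (Suc i) (Suc j) = (1 - x) * a i (Suc j) + x * a i j" for j
  proof (cases "Suc j \<le> i")
    case True
    then have "i - j = Suc (i - Suc j)" by simp
    then show ?thesis unfolding a_def by (simp add: algebra_simps)
  next
    case False
    then show ?thesis by (simp add: a_def binomial_eq_0)
  qed
  have "(\<Sum>j\<le>n. a (Suc i) j * p (n - j)) = mm_inf \<rho> x (Suc i) n"
  proof (cases n)
    case 0
    then show ?thesis by (simp add: a0 IH)
  next
    case (Suc m)
    have "(\<Sum>j\<le>Suc m. a (Suc i) j * p (Suc m - j)) =
          (1 - x) * a i 0 * p (Suc m) + (\<Sum>j\<le>m. ((1 - x) * a i (Suc j) + x * a i j) * p (m - j))"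
      by (simp only: sum.atMost_Suc_shift a0 aS) simp
    also have "\<dots> = (1 - x) * (\<Sum>j\<le>Suc m. a i j * p (Suc m - j)) + x * (\<Sum>j\<le>m. a i j * p (m - j))"
      by (simp only: sum.atMost_Suc_shift distrib_right distrib_left mult.assoc sum.distrib
          sum_distrib_left[symmetric]) simp
    finally show ?thesis by (simp only: Suc mm_inf.simps(2) nat.case IH)
  qed
  then show ?case by (simp add: a_def p_def)
qed

text \<open>The exponent i - 2j may be negative, hence integer powers of the nonzero base 1 - x.
  Multiplied by (1 - x)^n they become the natural powers (1 - x)^(i - j) (1 - x)^(n - j) of the
  convolution.\<close>

lemma mm_inf_sum_powi:
  assumes "\<rho> > 0" "0 < x" "x < 1"
  shows "mm_inf \<rho> x i n = \<rho> ^ n * (1 - x) ^ n * exp (- \<rho> * (1 - x)) *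
    (\<Sum>j = 0..min n i. real (i choose j) * \<rho> powi (- int j) * x ^ j *
        (1 - x) powi (int i - 2 * int j) * (1 / fact (n - j)))"
proof -
  have "mm_inf \<rho> x i n = (\<Sum>j\<in>{0..min n i}. real (i choose j) * x ^ j * (1 - x) ^ (i - j) *
     ((\<rho> * (1 - x)) ^ (n - j) / fact (n - j) * exp (- \<rho> * (1 - x))))"
    unfolding mm_inf_sum by (rule sum.mono_neutral_right) (auto simp: min_def binomial_eq_0)
  also have "\<dots> = (\<Sum>j = 0..min n i. \<rho> ^ n * (1 - x) ^ n * exp (- \<rho> * (1 - x)) *
       (real (i choose j) * \<rho> powi (- int j) * x ^ j *
        (1 - x) powi (int i - 2 * int j) * (1 / fact (n - j))))"
  proof (rule sum.cong)
    fix j assume "j \<in> {0..min n i}"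
    then have j: "j \<le> n" "j \<le> i" by auto
    have 1: "\<rho> ^ n * \<rho> powi (- int j) = \<rho> ^ (n - j)"
      using j assms by (simp add: power_int_minus power_diff field_simps)
    have eq: "int i - 2 * int j = int (i - j) - int j" using j by (simp add: of_nat_diff)
    have "(1 - x) powi (int i - 2 * int j) = (1 - x) ^ (i - j) / (1 - x) ^ j"
      unfolding eq by (subst power_int_diff) (use assms in auto)
    then have 2: "(1 - x) ^ n * (1 - x) powi (int i - 2 * int j) = (1 - x) ^ (i - j) * (1 - x) ^ (n - j)"
      using j assms by (simp add: power_diff)
    have 3: "\<rho> ^ n * (1 - x) ^ n * exp (- \<rho> * (1 - x)) *
       (real (i choose j) * \<rho> powi (- int j) * x ^ j *
        (1 - x) powi (int i - 2 * int j) * (1 / fact (n - j))) =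
        (\<rho> ^ n * \<rho> powi (- int j)) * ((1 - x) ^ n * (1 - x) powi (int i - 2 * int j)) *
        exp (- \<rho> * (1 - x)) * real (i choose j) * x ^ j / fact (n - j)"
      by simp
    show "real (i choose j) * x ^ j * (1 - x) ^ (i - j) *
     ((\<rho> * (1 - x)) ^ (n - j) / fact (n - j) * exp (- \<rho> * (1 - x))) =
     \<rho> ^ n * (1 - x) ^ n * exp (- \<rho> * (1 - x)) *
       (real (i choose j) * \<rho> powi (- int j) * x ^ j *
        (1 - x) powi (int i - 2 * int j) * (1 / fact (n - j)))"
      unfolding 3 1 2 by (simp add: power_mult_distrib mult_ac)
  qed simp
  finally show ?thesis by (simp add: sum_distrib_left)
qed

section \<open>Identification of the law of the process\<close>

text \<open>\<open>backward_equation_le_0\<close> is one-sided, so it is applied to the difference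
  and to its negative.\<close>

lemma transition_eq_mm_inf:
  assumes \<rho>: "\<rho> > 0" and tf: "transition_function P"
    and gen: "\<And>i j. ((\<lambda>h. P h i j) has_real_derivative bd_generator (\<lambda>_. \<rho>) real i j) (at 0 within {0..})"
    and t: "t \<ge> 0"
  shows "P t i n = mm_inf \<rho> (exp (- t)) i n"
proof -
  define w where "w t i = P t i n - mm_inf \<rho> (exp (- t)) i n" for t i
  have init: "w 0 i = 0" for i
    by (simp add: w_def transition_0[OF tf] mm_inf_1)
  have bound: "\<bar>w t i\<bar> \<le> 1" if "t \<ge> 0" for t i
    using transition_nonneg[OF tf that, of i n] transition_le_1[OF tf that, of i n]
      mm_inf_bounds[of \<rho> "exp (- t)" i n] \<rho> that by (auto simp: w_def abs_le_iff)
  have cont: "continuous_on {0..} (\<lambda>t. w t i)" for i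
    unfolding w_def by (intro continuous_intros transition_continuous[OF tf gen])
  have deriv: "((\<lambda>s. w s i) has_real_derivative
      \<rho> * (w t (Suc i) - w t i) + (if i = 0 then 0 else real i * (w t (i - 1) - w t i))) (at t)" if "t > 0" for t i
    using DERIV_diff[OF backward_equation[OF tf gen that, of i n] mm_inf_backward_equation[of \<rho> i n t]]
    unfolding w_def by (rule DERIV_cong) (simp add: algebra_simps)
  have "w t i \<le> 0"
    by (rule backward_equation_le_0[OF \<rho> init _ cont deriv t]) (use bound abs_le_D1 in blast)
  moreover have "- w t i \<le> 0"
  proof (rule backward_equation_le_0[of \<rho> "\<lambda>t i. - w t i" 1])
    fix t :: real and i assume "t > 0"
    show "((\<lambda>s. - w s i) has_real_derivative
      \<rho> * (- w t (Suc i) - - w t i) + (if i = 0 then 0 else real i * (- w t (i - 1) - - w t i))) (at t)"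
      using DERIV_minus[OF deriv[OF \<open>t > 0\<close>, of i]] by (rule DERIV_cong) (simp add: algebra_simps)
  next
    show "- w t i \<le> 1" if "t \<ge> 0" for t i using bound[OF that, of i] by linarith
  qed (use \<rho> init cont t in \<open>auto intro: continuous_intros\<close>)
  ultimately show ?thesis by (simp add: w_def)
qed

lemma trans_prob_eq_mm_inf:
  assumes \<rho>: "\<rho> > 0" and bd: "birth_death_process M N (\<lambda>_. \<rho>) (\<lambda>n. real n)"
    and initial: "AE \<omega> in M. N 0 \<omega> = n0" and t: "t \<ge> 0"
  shows "trans_prob M N n0 n t = mm_inf \<rho> (exp (- t)) n0 n"
proof -
  interpret prob_space M using bd by (simp add: birth_death_process_def)
  have [measurable]: "N s \<in> measurable M (count_space UNIV)" if "s \<ge> 0" for s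
    using bd that by (simp add: birth_death_process_def)
  obtain P where tf: "transition_function P"
    and gen: "\<And>i j. ((\<lambda>h. P h i j) has_real_derivative bd_generator (\<lambda>_. \<rho>) real i j) (at 0 within {0..})"
    and fdd: "\<And>(m::nat) (ts :: nat \<Rightarrow> real) (xs :: nat \<Rightarrow> nat). ts 0 = 0 \<Longrightarrow> (\<forall>l<m. ts l \<le> ts (Suc l)) \<Longrightarrow>
           measure M {\<omega> \<in> space M. \<forall>l\<le>m. N (ts l) \<omega> = xs l} =
             measure M {\<omega> \<in> space M. N 0 \<omega> = xs 0} *
             (\<Prod>l<m. P (ts (Suc l) - ts l) (xs l) (xs (Suc l)))"
    using bd unfolding birth_death_process_def by blast
  have N0: "N 0 \<in> measurable M (count_space UNIV)" using bd by (simp add: birth_death_process_def)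
  have one: "measure M {\<omega> \<in> space M. N 0 \<omega> = n0} = 1"
    using initial N0 by (subst prob_Collect_eq_1) auto
  \<comment> \<open>The joint law at the two times 0 and \<open>t\<close>; the conditioning event
    has probability 1.\<close>
  have "{\<omega> \<in> space M. \<forall>l\<le>Suc 0. N (if l = 0 then 0 else t) \<omega> = (if l = 0 then n0 else n)} =
        {\<omega> \<in> space M. N t \<omega> = n \<and> N 0 \<omega> = n0}"
    by (auto simp: le_Suc_eq)
  then have "measure M {\<omega> \<in> space M. N t \<omega> = n \<and> N 0 \<omega> = n0} = P t n0 n"
    using fdd[of "\<lambda>l. if l = 0 then 0 else t" "Suc 0" "\<lambda>l. if l = 0 then n0 else n"] t one by simp
  then show ?thesis
    unfolding trans_prob_def cond_prob_def one
    using transition_eq_mm_inf[OF \<rho> tf gen t] by simp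
qed

section \<open>Charlier polynomials and the spectral representation\<close>

text \<open>The coefficient of z^n in (1 - z)^k exp(\<rho>z), i.e. \<rho>^n/n! times the Charlier
  polynomial of degree n with parameter \<rho> at k.\<close>

definition charlier :: "real \<Rightarrow> nat \<Rightarrow> nat \<Rightarrow> real" where
  "charlier \<rho> n k = (\<Sum>j\<le>n. real (k choose j) * (- 1) ^ j * \<rho> ^ (n - j) / fact (n - j))"

lemma charlier_0_left [simp]: "charlier \<rho> 0 k = 1"
  by (simp add: charlier_def)

text \<open>Compare coefficients in the z-derivative of (1 - z)^k exp(\<rho>z). At
  \<open>k = 0\<close> the truncated \<open>k - 1\<close> is multiplied by 0.\<close>

lemma charlier_Suc_left:
  "real (Suc n) * charlier \<rho> (Suc n) k = \<rho> * charlier \<rho> n k - real k * charlier \<rho> n (k - 1)"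
proof -
  define a where "a k j = real (k choose j) * (- 1) ^ j" for k j
  define b where "b m = \<rho> ^ m / fact m" for m
  have c: "charlier \<rho> n k = (\<Sum>j\<le>n. a k j * b (n - j))" for n k
    by (simp add: charlier_def a_def b_def)
  have b: "real (Suc m) * b (Suc m) = \<rho> * b m" for m
    by (simp add: b_def divide_simps del: of_nat_Suc)
  have a: "real (Suc j) * a k (Suc j) = - (real k * a (k - 1) j)" for j
  proof (cases k)
    case (Suc m)
    have "real (Suc j * (Suc m choose Suc j)) = real (Suc m * (m choose j))"
      by (simp only: Suc_times_binomial)
    then have "real (Suc j) * real (Suc m choose Suc j) = real (Suc m) * real (m choose j)"
      by (simp only: of_nat_mult)
    then show ?thesis by (simp only: a_def Suc) (simp add: mult.assoc[symmetric] del: of_nat_Suc binomial_Suc_Suc)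
  qed (simp add: a_def)
  have "real (Suc n) * charlier \<rho> (Suc n) k =
        (\<Sum>j\<le>Suc n. a k j * (real (Suc n - j) * b (Suc n - j)) + real j * a k j * b (Suc n - j))"
    unfolding c sum_distrib_left
    by (rule sum.cong) (auto simp: algebra_simps of_nat_diff)
  also have "\<dots> = (\<Sum>j\<le>n. a k j * (real (Suc n - j) * b (Suc n - j))) + (\<Sum>j\<le>n. real (Suc j) * a k (Suc j) * b (n - j))"
  proof -
    have "(\<Sum>j\<le>Suc n. a k j * (real (Suc n - j) * b (Suc n - j))) =
          (\<Sum>j\<le>n. a k j * (real (Suc n - j) * b (Suc n - j)))" by simp
    moreover have "(\<Sum>j\<le>Suc n. real j * a k j * b (Suc n - j)) = (\<Sum>j\<le>n. real (Suc j) * a k (Suc j) * b (n - j))"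
      by (subst sum.atMost_Suc_shift) simp
    ultimately show ?thesis by (simp only: sum.distrib)
  qed
  also have "(\<Sum>j\<le>n. a k j * (real (Suc n - j) * b (Suc n - j))) = (\<Sum>j\<le>n. a k j * (\<rho> * b (n - j)))"
    by (rule sum.cong) (auto simp: Suc_diff_le b simp del: of_nat_Suc)
  also have "\<dots> = \<rho> * charlier \<rho> n k"
    by (simp add: c sum_distrib_left algebra_simps)
  also have "(\<Sum>j\<le>n. real (Suc j) * a k (Suc j) * b (n - j)) = - (real k * charlier \<rho> n (k - 1))"
    unfolding a by (simp add: c sum_distrib_left sum_negf algebra_simps)
  finally show ?thesis by simp
qed

text \<open>Multiplication of the generating function by 1 - z.\<close>

lemma charlier_Suc_right:
  "charlier \<rho> n (Suc k) = charlier \<rho> n k - (case n of 0 \<Rightarrow> 0 | Suc m \<Rightarrow> charlier \<rho> m k)"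
proof (cases n)
  case (Suc m)
  have *: "charlier \<rho> (Suc m) k = \<rho> ^ Suc m / fact (Suc m) +
      (\<Sum>j\<le>m. real (k choose Suc j) * (- 1) ^ Suc j * \<rho> ^ (m - j) / fact (m - j))" for k
    by (simp only: charlier_def sum.atMost_Suc_shift) simp
  show ?thesis
    unfolding Suc * by (simp add: charlier_def sum.distrib[symmetric] sum_negf[symmetric] algebra_simps flip: add_divide_distrib diff_divide_distrib)
qed simp

text \<open>A row of Pascal's triangle sums to 2^k. Geometric growth in \<open>k\<close> is enough,
  since the spectral series carries 1/k!.\<close>

lemma charlier_bound:
  assumes "\<rho> \<ge> 0"
  shows "\<bar>charlier \<rho> n k\<bar> \<le> 2 ^ k * exp \<rho>"
proof -
  have "\<bar>charlier \<rho> n k\<bar> \<le> (\<Sum>j\<le>n. real (k choose j) * exp \<rho>)"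
    unfolding charlier_def
  proof (rule order_trans[OF sum_abs], rule sum_mono)
    fix j
    have "\<bar>real (k choose j) * (- 1) ^ j * \<rho> ^ (n - j) / fact (n - j)\<bar> =
          real (k choose j) * (\<rho> ^ (n - j) / fact (n - j))"
      using assms by (simp add: abs_mult)
    also have "\<dots> \<le> real (k choose j) * exp \<rho>"
      by (intro mult_left_mono power_div_fact_le_exp assms) auto
    finally show "\<bar>real (k choose j) * (- 1) ^ j * \<rho> ^ (n - j) / fact (n - j)\<bar> \<le> real (k choose j) * exp \<rho>" .
  qed
  also have "\<dots> = real (\<Sum>j\<le>n. k choose j) * exp \<rho>"
    by (simp add: sum_distrib_right)
  also have "(\<Sum>j\<le>n. k choose j) \<le> (\<Sum>j\<le>k. k choose j)"
  proof -
    have "(\<Sum>j\<le>n. k choose j) \<le> (\<Sum>j\<le>max n k. k choose j)"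
      by (rule sum_mono2) auto
    also have "\<dots> = (\<Sum>j\<le>k. k choose j)"
      by (rule sum.mono_neutral_right) (auto simp: binomial_eq_0)
    finally show ?thesis .
  qed
  also have "(\<Sum>j\<le>k. k choose j) = 2 ^ k" by (rule choose_row_sum)
  finally show ?thesis by simp
qed

text \<open>The offsets \<open>l\<close> and \<open>m\<close> cover the shifted series that the
  recursions produce; the 4 is the product of the two bounds 2^k.\<close>

lemma charlier_series_summable:
  assumes "\<rho> \<ge> 0"
  shows "summable (\<lambda>k. y ^ k / fact k * charlier \<rho> i (k + l) * charlier \<rho> n (k + m))"
proof (rule summable_comparison_test')
  let ?C = "2 ^ l * exp \<rho> * (2 ^ m * exp \<rho>)"
  show "summable (\<lambda>k. ?C * ((4 * \<bar>y\<bar>) ^ k / fact k))"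
    by (intro summable_mult summable_exp_generic[of "4 * \<bar>y\<bar>", THEN summable_cong[THEN iffD1, rotated]])
       (simp add: field_simps)
  fix k :: nat
  have "norm (y ^ k / fact k * charlier \<rho> i (k + l) * charlier \<rho> n (k + m)) =
        \<bar>y\<bar> ^ k / fact k * (\<bar>charlier \<rho> i (k + l)\<bar> * \<bar>charlier \<rho> n (k + m)\<bar>)"
    by (simp add: abs_mult power_abs)
  also have "\<dots> \<le> \<bar>y\<bar> ^ k / fact k * ((2 ^ (k + l) * exp \<rho>) * (2 ^ (k + m) * exp \<rho>))"
    by (intro mult_left_mono mult_mono charlier_bound assms) auto
  also have "(2::real) ^ (k + l) * exp \<rho> * (2 ^ (k + m) * exp \<rho>) = ?C * 4 ^ k"
    by (simp add: power_add power_mult_distrib[symmetric] algebra_simps)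
  finally show "norm (y ^ k / fact k * charlier \<rho> i (k + l) * charlier \<rho> n (k + m)) \<le> ?C * ((4 * \<bar>y\<bar>) ^ k / fact k)"
    by (simp add: power_mult_distrib algebra_simps)
qed

text \<open>The factor k removes the term k = 0 and lowers the factorial by one; in this way the
  \<open>k - 1\<close> of \<open>charlier_Suc_left\<close> turns back into \<open>k\<close>.\<close>

lemma sums_mult_index:
  fixes y :: real
  assumes "summable (\<lambda>k. y ^ k / fact k * f (Suc k))"
  shows "(\<lambda>k. y ^ k / fact k * (real k * f k)) sums (y * (\<Sum>k. y ^ k / fact k * f (Suc k)))"
proof -
  have "(\<lambda>k. y * (y ^ k / fact k * f (Suc k))) sums (y * (\<Sum>k. y ^ k / fact k * f (Suc k)))"
    by (intro sums_mult summable_sums assms)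
  also have "(\<lambda>k. y * (y ^ k / fact k * f (Suc k))) = (\<lambda>k. y ^ Suc k / fact (Suc k) * (real (Suc k) * f (Suc k)))"
    by (auto simp: fun_eq_iff simp del: of_nat_Suc)
  finally show ?thesis
    by (subst (asm) sums_Suc_iff) simp
qed

text \<open>Summing \<open>charlier_Suc_left\<close> against the weights gives the series a
  recursion in \<open>i\<close>. The index shift this produces is removed by
  \<open>charlier_Suc_right\<close>, and what remains is the recursion of \<open>mm_inf\<close> up
  to normalization.\<close>

lemma mm_inf_spectral:
  assumes \<rho>: "\<rho> > 0"
  shows "(\<lambda>k. (\<rho> * x) ^ k / fact k * charlier \<rho> i k * charlier \<rho> n k) sums
     (mm_inf \<rho> x i n * \<rho> ^ i * exp \<rho> / fact i)"
proof -
  define y where "y = \<rho> * x"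
  define S where "S i n = (\<Sum>k. y ^ k / fact k * charlier \<rho> i k * charlier \<rho> n k)" for i n
  have summ: "summable (\<lambda>k. y ^ k / fact k * charlier \<rho> i k * charlier \<rho> n k)" for i n
    using charlier_series_summable[of \<rho> y i 0 n 0] \<rho> by simp
  then have S: "(\<lambda>k. y ^ k / fact k * charlier \<rho> i k * charlier \<rho> n k) sums S i n" for i n
    by (simp add: S_def summable_sums)
  have rec: "real (Suc i) * S (Suc i) n = \<rho> * S i n - y * (S i n - (case n of 0 \<Rightarrow> 0 | Suc m \<Rightarrow> S i m))" for i n
  proof -
    define T where "T = (\<Sum>k. y ^ k / fact k * (charlier \<rho> i k * charlier \<rho> n (Suc k)))"
    have su: "summable (\<lambda>k. y ^ k / fact k * (charlier \<rho> i (Suc k - 1) * charlier \<rho> n (Suc k)))"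
      using charlier_series_summable[of \<rho> y i 0 n 1] \<rho> by (simp add: mult.assoc)
    have "(\<lambda>k. y ^ k / fact k * (real k * (charlier \<rho> i (k - 1) * charlier \<rho> n k))) sums (y * T)"
      using sums_mult_index[where f = "\<lambda>k. charlier \<rho> i (k - 1) * charlier \<rho> n k", OF su] by (simp add: T_def)
    from sums_diff[OF sums_mult[OF S[of i n], of \<rho>] this]
    have "(\<lambda>k. \<rho> * (y ^ k / fact k * charlier \<rho> i k * charlier \<rho> n k) -
            y ^ k / fact k * (real k * (charlier \<rho> i (k - 1) * charlier \<rho> n k))) sums (\<rho> * S i n - y * T)" .
    also have "(\<lambda>k. \<rho> * (y ^ k / fact k * charlier \<rho> i k * charlier \<rho> n k) -
            y ^ k / fact k * (real k * (charlier \<rho> i (k - 1) * charlier \<rho> n k))) =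
          (\<lambda>k. y ^ k / fact k * (\<rho> * charlier \<rho> i k - real k * charlier \<rho> i (k - 1)) * charlier \<rho> n k)"
      by (simp add: fun_eq_iff algebra_simps)
    also have "\<dots> = (\<lambda>k. real (Suc i) * (y ^ k / fact k * charlier \<rho> (Suc i) k * charlier \<rho> n k))"
      unfolding charlier_Suc_left[symmetric] by (simp add: fun_eq_iff)
    finally have 1: "real (Suc i) * S (Suc i) n = \<rho> * S i n - y * T"
      using sums_mult[OF S[of "Suc i" n], of "real (Suc i)"] sums_unique2 by blast
    have "(\<lambda>k. y ^ k / fact k * (charlier \<rho> i k * charlier \<rho> n (Suc k))) sums
          (S i n - (case n of 0 \<Rightarrow> 0 | Suc m \<Rightarrow> S i m))"
    proof (cases n)
      case 0
      then show ?thesis using S[of i 0] by simp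
    next
      case (Suc m)
      from sums_diff[OF S[of i n] S[of i m]] show ?thesis
        unfolding Suc charlier_Suc_right by (simp add: algebra_simps)
    qed
    then have "T = S i n - (case n of 0 \<Rightarrow> 0 | Suc m \<Rightarrow> S i m)"
      unfolding T_def by (rule sums_unique[symmetric])
    with 1 show ?thesis by simp
  qed
  \<comment> \<open>The row \<open>i = 0\<close> is reached through the symmetry of \<open>S\<close>
    in its two indices: \<open>rec\<close> at second index 0 raises the first one.\<close>
  have S0: "S 0 n = exp y * (\<rho> * (1 - x)) ^ n / fact n" for n
  proof (induction n)
    case 0
    have "(\<lambda>k. y ^ k / fact k) sums exp y"
      using exp_converges[of y] by (simp add: field_simps)
    then show ?case using S[of 0 0] by (simp add: sums_iff)
  next
    case (Suc n)
    have "S 0 (Suc n) = S (Suc n) 0" "S 0 n = S n 0"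
      unfolding S_def by (simp_all add: mult.commute mult.left_commute)
    then have "real (Suc n) * S 0 (Suc n) = \<rho> * (1 - x) * S 0 n"
      using rec[of n 0] by (simp add: y_def algebra_simps)
    then have "S 0 (Suc n) = \<rho> * (1 - x) * S 0 n / real (Suc n)"
      by (simp add: field_simps)
    then show ?case unfolding Suc by (simp add: mult_ac)
  qed
  have "S i n = mm_inf \<rho> x i n * \<rho> ^ i * exp \<rho> / fact i" for i n
  proof (induction i arbitrary: n)
    case 0
    have "exp (- \<rho> * (1 - x)) * exp \<rho> = exp y"
      by (simp add: y_def algebra_simps flip: exp_add)
    then show ?case by (simp add: S0 mult.assoc)
  next
    case (Suc i)
    have "real (Suc i) * S (Suc i) n = \<rho> * ((1 - x) * S i n + x * (case n of 0 \<Rightarrow> 0 | Suc m \<Rightarrow> S i m))"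
      unfolding rec y_def by (simp add: algebra_simps)
    also have "\<dots> = \<rho> * (\<rho> ^ i * exp \<rho> / fact i) * mm_inf \<rho> x (Suc i) n"
      unfolding Suc by (cases n) (simp_all add: algebra_simps add_divide_distrib diff_divide_distrib)
    finally have "S (Suc i) n = \<rho> * (\<rho> ^ i * exp \<rho> / fact i) * mm_inf \<rho> x (Suc i) n / real (Suc i)"
      by (simp add: eq_divide_eq mult_ac del: mm_inf.simps of_nat_Suc)
    then show ?case by (simp add: mult_ac del: mm_inf.simps of_nat_Suc)
  qed
  with S[of i n] show ?thesis by (simp add: y_def)
qed

text \<open>Detailed balance with respect to the stationary weights, read off from the symmetry of
  the spectral series in \<open>i\<close> and \<open>n\<close>.\<close>

lemma mm_inf_reversible:
  assumes "\<rho> > 0"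
  shows "\<rho> ^ i / fact i * mm_inf \<rho> x i n = \<rho> ^ n / fact n * mm_inf \<rho> x n i"
proof -
  have "mm_inf \<rho> x i n * \<rho> ^ i * exp \<rho> / fact i = mm_inf \<rho> x n i * \<rho> ^ n * exp \<rho> / fact n"
    using sums_unique2[OF mm_inf_spectral[OF assms, of x i n]] mm_inf_spectral[OF assms, of x n i]
    by (simp add: mult.commute mult.left_commute)
  then show ?thesis by (simp add: field_simps)
qed

section \<open>The functions F\<close>

lemma one_minus_notin_nonpos_Reals:
  fixes z :: complex
  assumes "norm z < 1"
  shows "1 - z \<notin> \<real>\<^sub>\<le>\<^sub>0"
  using assms complex_Re_le_cmod[of z] by (auto simp: complex_nonpos_Reals_iff)

lemma F_fun_altdef:
  "F_fun r \<rho> n \<theta> = 1 / (2 * of_real pi * \<i>) *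
     contour_integral (circlepath 0 r) (\<lambda>z. exp (of_real \<rho> * z) * (1 - z) powr (- \<theta>) / z ^ (n + 1))"
  unfolding F_fun_def by (simp add: powr_minus field_simps)

context
  fixes r :: real
  assumes r: "0 < r" "r < 1"
begin

lemma F_fun_0: "F_fun r \<rho> 0 \<theta> = 1"
proof -
  have "(\<lambda>z. exp (of_real \<rho> * z) * (1 - z) powr (- \<theta>)) holomorphic_on cball 0 r"
    by (intro holomorphic_intros one_minus_notin_nonpos_Reals) (use r in auto)
  from Cauchy_integral_circlepath_simple[OF this, of 0] r show ?thesis
    unfolding F_fun_altdef by (simp add: contour_integral_unique)
qed

text \<open>The difference of the two sides is the integral over a closed circle of the derivative
  of exp(\<rho>z) (1 - z)^(-\<theta>) / z^(n+1). This function is single-valued on the punctured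
  unit disc, where 1 - z avoids the cut.\<close>

lemma F_fun_Suc:
  "of_nat (Suc n) * F_fun r \<rho> (Suc n) \<theta> = of_real \<rho> * F_fun r \<rho> n \<theta> + \<theta> * F_fun r \<rho> n (\<theta> + 1)"
proof -
  define f where "f n \<theta> z = exp (of_real \<rho> * z) * (1 - z) powr (- \<theta>) / z ^ (n + 1)" for n \<theta> and z :: complex
  define S :: "complex set" where "S = {z. z \<noteq> 0 \<and> norm z < 1}"
  have path: "path_image (circlepath 0 r) \<subseteq> S" using r by (auto simp: S_def)
  have "f n \<theta> holomorphic_on S" for n \<theta>
    unfolding f_def by (intro holomorphic_intros one_minus_notin_nonpos_Reals) (auto simp: S_def)
  then have int: "f n \<theta> contour_integrable_on circlepath 0 r" for n \<theta>
    using path by (blast intro: contour_integrable_continuous_circlepath holomorphic_on_imp_continuous_on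
        continuous_on_subset)
  have "((\<lambda>z. of_real \<rho> * f n \<theta> z + \<theta> * f n (\<theta> + 1) z - of_nat (Suc n) * f (Suc n) \<theta> z)
        has_contour_integral 0) (circlepath 0 r)"
  proof (rule Cauchy_theorem_primitive[where S = S])
    fix z assume z: "z \<in> S"
    then have nz: "z \<noteq> 0" "1 - z \<notin> \<real>\<^sub>\<le>\<^sub>0" using one_minus_notin_nonpos_Reals by (auto simp: S_def)
    have "((\<lambda>z. exp (of_real \<rho> * z) * (1 - z) powr (- \<theta>) / z ^ Suc n) has_field_derivative
            of_real \<rho> * f n \<theta> z + \<theta> * f n (\<theta> + 1) z - of_nat (Suc n) * f (Suc n) \<theta> z) (at z)"
      using nz
      by (auto intro!: derivative_eq_intros simp: f_def diff_conv_add_uminus[of "- \<theta>"] simp del: add_uminus_conv_diff)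
        (cases n; simp add: field_simps)
    then show "((\<lambda>z. exp (of_real \<rho> * z) * (1 - z) powr (- \<theta>) / z ^ Suc n) has_field_derivative
            of_real \<rho> * f n \<theta> z + \<theta> * f n (\<theta> + 1) z - of_nat (Suc n) * f (Suc n) \<theta> z) (at z within S)"
      by (rule has_field_derivative_at_within)
  qed (use path in auto)
  moreover have "((\<lambda>z. of_real \<rho> * f n \<theta> z + \<theta> * f n (\<theta> + 1) z - of_nat (Suc n) * f (Suc n) \<theta> z)
        has_contour_integral
          of_real \<rho> * contour_integral (circlepath 0 r) (f n \<theta>)
          + \<theta> * contour_integral (circlepath 0 r) (f n (\<theta> + 1))
          - of_nat (Suc n) * contour_integral (circlepath 0 r) (f (Suc n) \<theta>)) (circlepath 0 r)"
    by (intro has_contour_integral_add has_contour_integral_diff has_contour_integral_lmul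
        has_contour_integral_integral int)
  ultimately have "0 = of_real \<rho> * contour_integral (circlepath 0 r) (f n \<theta>)
          + \<theta> * contour_integral (circlepath 0 r) (f n (\<theta> + 1))
          - of_nat (Suc n) * contour_integral (circlepath 0 r) (f (Suc n) \<theta>)"
    by (rule has_contour_integral_unique)
  moreover have F: "F_fun r \<rho> n \<theta> = 1 / (2 * of_real pi * \<i>) * contour_integral (circlepath 0 r) (f n \<theta>)" for n \<theta>
    unfolding F_fun_altdef f_def ..
  ultimately show ?thesis
    unfolding F by (simp add: field_simps)
qed

lemma F_fun_neg_nat: "F_fun r \<rho> n (- of_nat k) = of_real (charlier \<rho> n k)"
proof (induction n arbitrary: k)
  case 0
  then show ?case by (simp add: F_fun_0)
next
  case (Suc n)
  \<comment> \<open>At \<open>k = 0\<close> the shifted argument is 1, outside the induction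
    hypothesis, but the factor \<open>k\<close> is then 0.\<close>
  have shift: "of_nat k * F_fun r \<rho> n (- of_nat k + 1) = of_nat k * of_real (charlier \<rho> n (k - 1))"
  proof (cases k)
    case (Suc m)
    then show ?thesis using Suc.IH[of m] by simp
  qed simp
  have "of_nat (Suc n) * F_fun r \<rho> (Suc n) (- of_nat k) =
        complex_of_real (\<rho> * charlier \<rho> n k - real k * charlier \<rho> n (k - 1))"
    unfolding F_fun_Suc Suc using shift by simp
  also have "\<dots> = of_nat (Suc n) * of_real (charlier \<rho> (Suc n) k)"
    unfolding charlier_Suc_left[symmetric] by simp
  finally show ?case by (simp del: of_nat_Suc)
qed

lemma F_fun_neg_nat_integral:
  "F_fun r \<rho> n (- of_nat k) = 1 / (2 * of_real pi * \<i>) *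
     contour_integral (circlepath 0 r) (\<lambda>z. (1 - z) ^ k / z ^ (n + 1) * exp (of_real \<rho> * z))"
proof -
  have "contour_integral (circlepath 0 r) (\<lambda>z. exp (of_real \<rho> * z) * (1 - z) powr (- (- of_nat k)) / z ^ (n + 1)) =
        contour_integral (circlepath 0 r) (\<lambda>z. (1 - z) ^ k / z ^ (n + 1) * exp (of_real \<rho> * z))"
  proof (rule contour_integral_cong)
    fix z assume "z \<in> path_image (circlepath 0 r)"
    then have "1 - z \<noteq> 0" using r by auto
    then show "exp (of_real \<rho> * z) * (1 - z) powr (- (- of_nat k)) / z ^ (n + 1) =
        (1 - z) ^ k / z ^ (n + 1) * exp (of_real \<rho> * z)"
      by (simp add: powr_nat')
  qed simp
  then show ?thesis unfolding F_fun_altdef by simp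
qed

end

lemma charlier_eq_sum_min:
  "charlier \<rho> n k = (\<Sum>j = 0..min k n. real (k choose j) * (- 1) ^ j * \<rho> ^ (n - j) / fact (n - j))"
  unfolding charlier_def by (rule sum.mono_neutral_right) (auto simp: min_def binomial_eq_0)

section \<open>Hankel integrals\<close>

text \<open>Written as the complement of the image of a real ray, the form in which
  \<open>starlike_slotted_complex_plane_left\<close> and \<open>closed_slot_left\<close>
  apply.\<close>

definition slit_plane :: "complex set" where
  "slit_plane = - complex_of_real ` {..1}"

lemma mem_slit_plane: "z \<in> slit_plane \<longleftrightarrow> \<not> (Im z = 0 \<and> Re z \<le> 1)"
  unfolding slit_plane_def by (auto simp: complex_slot_left_eq)

lemma slit_plane_minus_1: "z \<in> slit_plane \<longleftrightarrow> z - 1 \<notin> \<real>\<^sub>\<le>\<^sub>0"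
  by (auto simp: mem_slit_plane complex_nonpos_Reals_iff)

lemma open_slit_plane: "open slit_plane"
  unfolding slit_plane_def by (intro open_Compl closed_slot_left)

lemma hankel_middle_slit_plane:
  "hankel_middle \<epsilon> g \<Longrightarrow> path_image g \<subseteq> slit_plane"
  unfolding hankel_middle_def by (auto simp: mem_slit_plane)

text \<open>Holomorphic functions whose growth makes all Hankel integrals converge and independent of the
  contour.\<close>

definition hankel_admissible :: "real \<Rightarrow> (complex \<Rightarrow> complex) \<Rightarrow> bool" where
  "hankel_admissible \<rho> f \<longleftrightarrow> f holomorphic_on slit_plane \<and>
     (\<forall>\<epsilon>>0. \<exists>C\<ge>0. \<forall>z. \<bar>Im z\<bar> \<ge> \<epsilon> \<longrightarrow> norm (f z) \<le> C * exp (\<rho> * Re z))"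

lemma hankel_admissible_bound:
  assumes "hankel_admissible \<rho> f" "\<epsilon> > 0"
  obtains C where "C \<ge> 0" "\<And>z. \<bar>Im z\<bar> \<ge> \<epsilon> \<Longrightarrow> norm (f z) \<le> C * exp (\<rho> * Re z)"
  using assms unfolding hankel_admissible_def by blast

lemma hankel_admissible_holomorphic:
  "hankel_admissible \<rho> f \<Longrightarrow> f holomorphic_on slit_plane"
  by (simp add: hankel_admissible_def)

lemma hankel_admissible_cmult:
  assumes "hankel_admissible \<rho> f"
  shows "hankel_admissible \<rho> (\<lambda>z. c * f z)"
  unfolding hankel_admissible_def
proof safe
  show "(\<lambda>z. c * f z) holomorphic_on slit_plane"
    using assms by (auto intro!: holomorphic_intros simp: hankel_admissible_def)
  fix \<epsilon> :: real assume "\<epsilon> > 0"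
  then obtain C where C: "C \<ge> 0" "\<And>z. \<bar>Im z\<bar> \<ge> \<epsilon> \<Longrightarrow> norm (f z) \<le> C * exp (\<rho> * Re z)"
    using hankel_admissible_bound[OF assms] by metis
  show "\<exists>C\<ge>0. \<forall>z. \<epsilon> \<le> \<bar>Im z\<bar> \<longrightarrow> cmod (c * f z) \<le> C * exp (\<rho> * Re z)"
    using C by (intro exI[of _ "norm c * C"]) (auto simp: norm_mult mult.assoc intro!: mult_left_mono)
qed

lemma hankel_admissible_add:
  assumes "hankel_admissible \<rho> f" "hankel_admissible \<rho> h"
  shows "hankel_admissible \<rho> (\<lambda>z. f z + h z)"
  unfolding hankel_admissible_def
proof safe
  show "(\<lambda>z. f z + h z) holomorphic_on slit_plane"
    using assms by (auto intro!: holomorphic_intros simp: hankel_admissible_def)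
  fix \<epsilon> :: real assume \<epsilon>: "\<epsilon> > 0"
  obtain C where C: "C \<ge> 0" "\<And>z. \<bar>Im z\<bar> \<ge> \<epsilon> \<Longrightarrow> norm (f z) \<le> C * exp (\<rho> * Re z)"
    using hankel_admissible_bound[OF assms(1) \<epsilon>] by metis
  obtain D where D: "D \<ge> 0" "\<And>z. \<bar>Im z\<bar> \<ge> \<epsilon> \<Longrightarrow> norm (h z) \<le> D * exp (\<rho> * Re z)"
    using hankel_admissible_bound[OF assms(2) \<epsilon>] by metis
  show "\<exists>C\<ge>0. \<forall>z. \<epsilon> \<le> \<bar>Im z\<bar> \<longrightarrow> cmod (f z + h z) \<le> C * exp (\<rho> * Re z)"
    using C(1) D(1) norm_triangle_mono[OF C(2) D(2)]
    by (intro exI[of _ "C + D"]) (auto simp: distrib_right)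
qed

lemma set_integrable_exp_atMost:
  fixes a \<rho> :: real
  assumes "\<rho> > 0"
  shows "set_integrable lborel {..a} (\<lambda>x. exp (\<rho> * x))"
proof -
  have "set_integrable lborel (einterval (-\<infinity>) (ereal (a + 1))) (\<lambda>x. exp (\<rho> * x))"
  proof (rule interval_integral_FTC_nonneg(1)[where F = "\<lambda>x. exp (\<rho> * x) / \<rho>" and A = 0
        and B = "exp (\<rho> * (a + 1)) / \<rho>"])
    show "(((\<lambda>x. exp (\<rho> * x) / \<rho>) \<circ> real_of_ereal) \<longlongrightarrow> 0) (at_right (- \<infinity>))"
      unfolding ereal_tendsto_simps
      using assms by real_asymp
    show "(((\<lambda>x. exp (\<rho> * x) / \<rho>) \<circ> real_of_ereal) \<longlongrightarrow> exp (\<rho> * (a + 1)) / \<rho>) (at_left (ereal (a + 1)))"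
      unfolding ereal_tendsto_simps by (intro tendsto_intros) (use assms in auto)
  qed (use assms in \<open>auto intro!: derivative_eq_intros continuous_intros\<close>)
  then show ?thesis
    by (rule set_integrable_subset) (auto simp: einterval_def)
qed

text \<open>A mean value estimate on vertical segments of fixed length: where its derivative decays,
  a primitive has the same asymptotics at all heights.\<close>

lemma tendsto_vertical_difference:
  fixes x :: "nat \<Rightarrow> real"
  assumes \<Phi>: "\<And>n z. Re z = x n \<Longrightarrow> Im z \<in> closed_segment a b \<Longrightarrow> (\<Phi> has_field_derivative f z) (at z)"
    and bound: "\<And>n z. Re z = x n \<Longrightarrow> Im z \<in> closed_segment a b \<Longrightarrow> norm (f z) \<le> B n"
    and B: "B \<longlonglongrightarrow> 0"
  shows "(\<lambda>n. \<Phi> (Complex (x n) a) - \<Phi> (Complex (x n) b)) \<longlonglongrightarrow> 0"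
proof (rule Lim_null_comparison)
  show "(\<lambda>n. B n * \<bar>a - b\<bar>) \<longlonglongrightarrow> 0" using tendsto_mult_right[OF B] by simp
  show "\<forall>\<^sub>F n in sequentially. norm (\<Phi> (Complex (x n) a) - \<Phi> (Complex (x n) b)) \<le> B n * \<bar>a - b\<bar>"
  proof (intro always_eventually allI)
    fix n
    let ?S = "closed_segment (Complex (x n) a) (Complex (x n) b)"
    have S: "Re z = x n" "Im z \<in> closed_segment a b" if "z \<in> ?S" for z
      using that by (simp_all add: closed_segment_same_Re)
    have "norm (\<Phi> (Complex (x n) a) - \<Phi> (Complex (x n) b)) \<le> B n * norm (Complex (x n) a - Complex (x n) b)"
      by (rule field_differentiable_bound[where S = ?S and f' = f])
        (use S \<Phi> bound in \<open>auto intro: has_field_derivative_at_within\<close>)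
    also have "norm (Complex (x n) a - Complex (x n) b) = \<bar>a - b\<bar>"
      by (simp add: cmod_def)
    finally show "norm (\<Phi> (Complex (x n) a) - \<Phi> (Complex (x n) b)) \<le> B n * \<bar>a - b\<bar>" .
  qed
qed

section \<open>Integration along Hankel contours by primitives\<close>

context
  fixes \<rho> :: real
  assumes \<rho>: "\<rho> > 0"
begin

lemma set_integrable_ray:
  assumes f: "hankel_admissible \<rho> f" and \<epsilon>: "\<epsilon> \<noteq> 0"
  shows "set_integrable lborel {..a} (\<lambda>x. f (Complex x \<epsilon>))"
proof -
  have "\<bar>\<epsilon>\<bar> > 0" using \<epsilon> by simp
  then obtain C where C: "C \<ge> 0" "\<And>z. \<bar>Im z\<bar> \<ge> \<bar>\<epsilon>\<bar> \<Longrightarrow> norm (f z) \<le> C * exp (\<rho> * Re z)"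
    using hankel_admissible_bound[OF f] by metis
  have cont: "continuous_on {..a} (\<lambda>x. f (Complex x \<epsilon>))"
    by (rule continuous_on_compose2[OF holomorphic_on_imp_continuous_on[OF hankel_admissible_holomorphic[OF f]]])
      (use \<epsilon> in \<open>auto intro!: continuous_intros simp: mem_slit_plane Complex_eq\<close>)
  show ?thesis
  proof (rule set_integrable_bound)
    show "set_integrable lborel {..a} (\<lambda>x. C * exp (\<rho> * x))"
      by (intro set_integrable_mult_right set_integrable_exp_atMost \<rho>)
    show "set_borel_measurable lborel {..a} (\<lambda>x. f (Complex x \<epsilon>))"
      unfolding set_borel_measurable_def
      using borel_measurable_continuous_on_indicator[OF _ cont] by simp
    show "AE x in lborel. x \<in> {..a} \<longrightarrow> norm (f (Complex x \<epsilon>)) \<le> norm (C * exp (\<rho> * x))"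
      using C(2)[of "Complex _ \<epsilon>"] C(1) by (intro AE_I2) (auto simp: abs_mult)
  qed
qed

text \<open>The limit is stated for the difference, so that no limit of \<Phi> at the far end has to
  be known beforehand.\<close>

lemma ray_integral_tendsto:
  assumes f: "hankel_admissible \<rho> f" and \<epsilon>: "\<epsilon> \<noteq> 0"
    and \<Phi>: "\<And>z. z \<in> slit_plane \<Longrightarrow> (\<Phi> has_field_derivative f z) (at z)"
  shows "(\<lambda>n. \<Phi> (Complex a \<epsilon>) - \<Phi> (Complex (- real n) \<epsilon>)) \<longlonglongrightarrow> (LINT x:{..a}|lborel. f (Complex x \<epsilon>))"
proof -
  have U: "(\<Union>n. {- real n..a}) = {..a}"
  proof safe
    fix x assume "x \<le> a"
    moreover obtain n where "- x \<le> real n" using real_arch_simple by blast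
    ultimately show "x \<in> (\<Union>n. {- real n..a})" by (intro UN_I[of n]) auto
  qed auto
  have "(\<lambda>n. LINT x:{- real n..a}|lborel. f (Complex x \<epsilon>)) \<longlonglongrightarrow> (LINT x:{..a}|lborel. f (Complex x \<epsilon>))"
    using set_integral_cont_up[of "\<lambda>n. {- real n..a}" lborel "\<lambda>x. f (Complex x \<epsilon>)"]
      set_integrable_ray[OF f \<epsilon>, of a]
    unfolding U by (auto simp: incseq_def)
  moreover have "\<forall>\<^sub>F n in sequentially. (LINT x:{- real n..a}|lborel. f (Complex x \<epsilon>)) =
      \<Phi> (Complex a \<epsilon>) - \<Phi> (Complex (- real n) \<epsilon>)"
  proof -
    obtain N where N: "- a \<le> real N" using real_arch_simple by blast
    show ?thesis
    proof (rule eventually_mono[OF eventually_ge_at_top[of N]])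
      fix n assume "N \<le> n"
      then have n: "- real n \<le> a" using N by linarith
      have line: "Complex x \<epsilon> \<in> slit_plane" for x using \<epsilon> by (simp add: mem_slit_plane)
      have der: "((\<lambda>x. Complex x \<epsilon>) has_vector_derivative 1) (at x within S)" for x S
        unfolding Complex_eq by (auto intro!: derivative_eq_intros)
      have "((\<lambda>x. \<Phi> (Complex x \<epsilon>)) has_vector_derivative f (Complex x \<epsilon>)) (at x within {- real n..a})" for x
        using field_vector_diff_chain_within[OF der[of x "{- real n..a}"] has_field_derivative_at_within[OF \<Phi>[OF line]]]
        by (simp add: o_def)
      moreover have "continuous_on {- real n..a} (\<lambda>x. f (Complex x \<epsilon>))"
        by (rule continuous_on_compose2[OF holomorphic_on_imp_continuous_on[OF hankel_admissible_holomorphic[OF f]]])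
          (use \<epsilon> in \<open>auto intro!: continuous_intros simp: mem_slit_plane Complex_eq\<close>)
      ultimately show "(LINT x:{- real n..a}|lborel. f (Complex x \<epsilon>)) =
          \<Phi> (Complex a \<epsilon>) - \<Phi> (Complex (- real n) \<epsilon>)"
        unfolding set_lebesgue_integral_def using n
        by (intro integral_FTC_atLeastAtMost) auto
    qed
  qed
  ultimately show ?thesis
    by (rule Lim_transform_eventually)
qed

text \<open>The values of \<Phi> at the two ends of \<open>g\<close> cancel between the three
  pieces. The integral thus depends only on \<Phi> far to the left, above and below the
  slit.\<close>

lemma hankel_integral_primitive:
  assumes f: "hankel_admissible \<rho> f" and g: "hankel_middle \<epsilon> g"
    and \<Phi>: "\<And>z. z \<in> slit_plane \<Longrightarrow> (\<Phi> has_field_derivative f z) (at z)"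
  shows "(\<lambda>n. \<Phi> (Complex (- real n) \<epsilon>) - \<Phi> (Complex (- real n) (- \<epsilon>))) \<longlonglongrightarrow> hankel_integral \<epsilon> g f"
proof -
  have \<epsilon>: "\<epsilon> > 0" and vp: "valid_path g"
    and ends: "pathstart g = Complex (Re (pathstart g)) (- \<epsilon>)" "pathfinish g = Complex (Re (pathfinish g)) \<epsilon>"
    using g by (auto simp: hankel_middle_def complex_eq_iff)
  have "contour_integral g f = \<Phi> (pathfinish g) - \<Phi> (pathstart g)"
    by (rule contour_integral_unique, rule contour_integral_primitive[OF has_field_derivative_at_within[OF \<Phi>]])
      (use vp hankel_middle_slit_plane[OF g] in auto)
  moreover have "(\<lambda>n. (\<Phi> (pathstart g) - \<Phi> (Complex (- real n) (- \<epsilon>))) + (\<Phi> (pathfinish g) - \<Phi> (pathstart g))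
        - (\<Phi> (pathfinish g) - \<Phi> (Complex (- real n) \<epsilon>))) \<longlonglongrightarrow>
      (LINT x:{..Re (pathstart g)}|lborel. f (Complex x (- \<epsilon>))) + (\<Phi> (pathfinish g) - \<Phi> (pathstart g))
      - (LINT x:{..Re (pathfinish g)}|lborel. f (Complex x \<epsilon>))"
    using ray_integral_tendsto[OF f _ \<Phi>, of "- \<epsilon>" "Re (pathstart g)"]
      ray_integral_tendsto[OF f _ \<Phi>, of \<epsilon> "Re (pathfinish g)"] \<epsilon>
    by (intro tendsto_intros) (simp_all flip: ends)
  ultimately show ?thesis
    unfolding hankel_integral_def by simp
qed

text \<open>The slit plane is starlike, so one single-valued primitive serves both sides of the
  slit.\<close>

lemma hankel_admissible_primitive:
  assumes "hankel_admissible \<rho> f"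
  obtains \<Phi> where "\<And>z. z \<in> slit_plane \<Longrightarrow> (\<Phi> has_field_derivative f z) (at z)"
proof -
  have "\<exists>\<Phi>. \<forall>z\<in>slit_plane. (\<Phi> has_field_derivative f z) (at z)"
  proof (rule holomorphic_starlike_primitive[where k = "{}"])
    show "starlike slit_plane"
      unfolding slit_plane_def by (rule starlike_slotted_complex_plane_left)
    show "continuous_on slit_plane f"
      by (intro holomorphic_on_imp_continuous_on hankel_admissible_holomorphic[OF assms])
    show "f field_differentiable at z" if "z \<in> slit_plane - {}" for z
      using that hankel_admissible_holomorphic[OF assms] open_slit_plane
      by (auto intro: holomorphic_on_imp_differentiable_at)
  qed (use open_slit_plane in auto)
  then show ?thesis using that by blast
qed

lemma exp_neg_tendsto_0: "(\<lambda>n. C * exp (- (\<rho> * real n))) \<longlonglongrightarrow> 0"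
  using \<rho> by real_asymp

text \<open>Far to the left the ends at heights \<epsilon> and \<epsilon>' are joined by vertical
  segments, likewise below the slit. On these |Im z| is at least the smaller height, so
  \<open>f\<close> decays exponentially there.\<close>

lemma hankel_integral_indep:
  assumes f: "hankel_admissible \<rho> f" and g: "hankel_middle \<epsilon> g" and g': "hankel_middle \<epsilon>' g'"
  shows "hankel_integral \<epsilon> g f = hankel_integral \<epsilon>' g' f"
proof -
  obtain \<Phi> where \<Phi>: "\<And>z. z \<in> slit_plane \<Longrightarrow> (\<Phi> has_field_derivative f z) (at z)"
    using hankel_admissible_primitive[OF f] by blast
  have \<epsilon>: "\<epsilon> > 0" "\<epsilon>' > 0" using g g' by (auto simp: hankel_middle_def)
  then obtain C where C: "C \<ge> 0" "\<And>z. \<bar>Im z\<bar> \<ge> min \<epsilon> \<epsilon>' \<Longrightarrow> norm (f z) \<le> C * exp (\<rho> * Re z)"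
    using hankel_admissible_bound[OF f, of "min \<epsilon> \<epsilon>'"] by auto
  have *: "(\<lambda>n. \<Phi> (Complex (- real n) a) - \<Phi> (Complex (- real n) b)) \<longlonglongrightarrow> 0"
    if "\<And>y. y \<in> closed_segment a b \<Longrightarrow> \<bar>y\<bar> \<ge> min \<epsilon> \<epsilon>'" for a b
  proof (rule tendsto_vertical_difference[OF _ _ exp_neg_tendsto_0[of C]])
    fix n z assume z: "Re z = - real n" "Im z \<in> closed_segment a b"
    then have "\<bar>Im z\<bar> \<ge> min \<epsilon> \<epsilon>'" using that by blast
    then show "(\<Phi> has_field_derivative f z) (at z)" "norm (f z) \<le> C * exp (- (\<rho> * real n))"
      using \<epsilon> C(2)[of z] z by (auto intro!: \<Phi> simp: mem_slit_plane min_def split: if_splits)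
  qed
  have "(\<lambda>n. \<Phi> (Complex (- real n) \<epsilon>') - \<Phi> (Complex (- real n) \<epsilon>)) \<longlonglongrightarrow> 0"
    by (rule *) (use \<epsilon> in \<open>auto simp: closed_segment_eq_real_ivl split: if_splits\<close>)
  moreover have "(\<lambda>n. \<Phi> (Complex (- real n) (- \<epsilon>)) - \<Phi> (Complex (- real n) (- \<epsilon>'))) \<longlonglongrightarrow> 0"
    by (rule *) (use \<epsilon> in \<open>auto simp: closed_segment_eq_real_ivl split: if_splits\<close>)
  ultimately have "(\<lambda>n. (\<Phi> (Complex (- real n) \<epsilon>) - \<Phi> (Complex (- real n) (- \<epsilon>))) +
      ((\<Phi> (Complex (- real n) \<epsilon>') - \<Phi> (Complex (- real n) \<epsilon>)) +
      (\<Phi> (Complex (- real n) (- \<epsilon>)) - \<Phi> (Complex (- real n) (- \<epsilon>'))))) \<longlonglongrightarrow>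
      hankel_integral \<epsilon> g f + (0 + 0)"
    by (intro tendsto_add hankel_integral_primitive[OF f g \<Phi>])
  then have "(\<lambda>n. \<Phi> (Complex (- real n) \<epsilon>') - \<Phi> (Complex (- real n) (- \<epsilon>'))) \<longlonglongrightarrow> hankel_integral \<epsilon> g f"
    by (simp add: algebra_simps)
  then show ?thesis
    using hankel_integral_primitive[OF f g' \<Phi>] LIMSEQ_unique by blast
qed

text \<open>Here the primitive is itself admissible, so its values at both far ends tend to 0. This
  is what makes integration by parts free of boundary terms.\<close>

lemma hankel_integral_derivative:
  assumes f: "hankel_admissible \<rho> f" and F: "hankel_admissible \<rho> F" and g: "hankel_middle \<epsilon> g"
    and deriv: "\<And>z. z \<in> slit_plane \<Longrightarrow> (F has_field_derivative f z) (at z)"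
  shows "hankel_integral \<epsilon> g f = 0"
proof -
  have \<epsilon>: "\<epsilon> > 0" using g by (simp add: hankel_middle_def)
  obtain C where C: "C \<ge> 0" "\<And>z. \<bar>Im z\<bar> \<ge> \<epsilon> \<Longrightarrow> norm (F z) \<le> C * exp (\<rho> * Re z)"
    using hankel_admissible_bound[OF F \<epsilon>] by metis
  have *: "(\<lambda>n. F (Complex (- real n) y)) \<longlonglongrightarrow> 0" if "\<bar>y\<bar> = \<epsilon>" for y
    by (rule Lim_null_comparison[OF _ exp_neg_tendsto_0[of C]])
      (use C(2)[of "Complex (- real _) y"] that in \<open>auto intro!: always_eventually\<close>)
  have "(\<lambda>n. F (Complex (- real n) \<epsilon>) - F (Complex (- real n) (- \<epsilon>))) \<longlonglongrightarrow> 0 - 0"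
    by (intro tendsto_diff *) (use \<epsilon> in auto)
  then show ?thesis
    using hankel_integral_primitive[OF f g deriv] LIMSEQ_unique by fastforce
qed

lemma hankel_integral_add:
  assumes f: "hankel_admissible \<rho> f" and h: "hankel_admissible \<rho> h" and g: "hankel_middle \<epsilon> g"
  shows "hankel_integral \<epsilon> g (\<lambda>z. f z + h z) = hankel_integral \<epsilon> g f + hankel_integral \<epsilon> g h"
proof -
  have \<epsilon>: "\<epsilon> \<noteq> 0" "- \<epsilon> \<noteq> 0" and vp: "valid_path g" using g by (auto simp: hankel_middle_def)
  have "contour_integral g (\<lambda>z. f z + h z) = contour_integral g f + contour_integral g h"
    by (intro contour_integral_add contour_integrable_holomorphic_simple[OF _ open_slit_plane vp]
        hankel_admissible_holomorphic[OF f] hankel_admissible_holomorphic[OF h] hankel_middle_slit_plane[OF g])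
  then show ?thesis
    unfolding hankel_integral_def
    by (simp add: set_integral_add set_integrable_ray[OF f] set_integrable_ray[OF h] \<epsilon>)
qed

lemma hankel_integral_cmult:
  assumes f: "hankel_admissible \<rho> f" and g: "hankel_middle \<epsilon> g"
  shows "hankel_integral \<epsilon> g (\<lambda>z. c * f z) = c * hankel_integral \<epsilon> g f"
proof -
  have \<epsilon>: "\<epsilon> \<noteq> 0" "- \<epsilon> \<noteq> 0" and vp: "valid_path g" using g by (auto simp: hankel_middle_def)
  have "contour_integral g (\<lambda>z. c * f z) = c * contour_integral g f"
    by (intro contour_integral_lmul contour_integrable_holomorphic_simple[OF _ open_slit_plane vp]
        hankel_admissible_holomorphic[OF f] hankel_middle_slit_plane[OF g])
  then show ?thesis
    unfolding hankel_integral_def by (simp add: algebra_simps)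
qed

end

section \<open>The kernel of \<open>G\<close> and its contiguity relations\<close>

text \<open>The norm of \<open>z powr \<theta>\<close> is |z|^(Re \<theta>) exp(-Im \<theta> arg z),
  and |arg z| \<le> \<pi>.\<close>

lemma norm_powr_ge:
  fixes z \<theta> :: complex
  assumes "z \<noteq> 0"
  shows "norm z powr Re \<theta> * exp (- pi * \<bar>Im \<theta>\<bar>) \<le> norm (z powr \<theta>)"
proof -
  have "Im \<theta> * Im (Ln z) \<le> \<bar>Im \<theta>\<bar> * \<bar>Im (Ln z)\<bar>" by (simp add: abs_mult[symmetric])
  also have "\<dots> \<le> \<bar>Im \<theta>\<bar> * pi"
    using Im_Ln_le_pi[OF assms] mpi_less_Im_Ln[OF assms] by (intro mult_left_mono) auto
  finally have *: "Im \<theta> * Im (Ln z) \<le> \<bar>Im \<theta>\<bar> * pi" .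
  have "norm z powr Re \<theta> * exp (- pi * \<bar>Im \<theta>\<bar>) = exp (Re \<theta> * ln (norm z) - pi * \<bar>Im \<theta>\<bar>)"
    using assms by (simp add: powr_def flip: exp_add)
  also have "\<dots> \<le> exp (Re \<theta> * ln (norm z) - Im \<theta> * Im (Ln z))"
    using * by (simp add: mult.commute)
  also have "\<dots> = norm (z powr \<theta>)"
    using assms by (simp add: powr_def norm_exp_eq_Re)
  finally show ?thesis .
qed

text \<open>The exponent \<open>m\<close> stands for the \<open>n + 1\<close> of
  \<open>G_integrand\<close> and also admits \<open>m = 0\<close>, which up to translation and
  scaling is Hankel's integrand for the reciprocal Gamma function.\<close>

definition hankel_kernel :: "real \<Rightarrow> nat \<Rightarrow> complex \<Rightarrow> complex \<Rightarrow> complex" where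
  "hankel_kernel \<rho> m \<theta> z = exp (of_real \<rho> * z) / (z ^ m * (z - 1) powr \<theta>)"

lemma G_integrand_hankel_kernel: "G_integrand \<rho> n \<theta> = hankel_kernel \<rho> (Suc n) \<theta>"
  by (simp add: fun_eq_iff G_integrand_def hankel_kernel_def)

text \<open>At height at least \<epsilon> both |z| and |z - 1| are at least \<epsilon>; Re \<theta>
  \<ge> 0 turns this into the lower bound \<open>c\<close> for the denominator.\<close>

lemma hankel_kernel_admissible:
  assumes "Re \<theta> \<ge> 0"
  shows "hankel_admissible \<rho> (hankel_kernel \<rho> m \<theta>)"
  unfolding hankel_admissible_def
proof safe
  show "hankel_kernel \<rho> m \<theta> holomorphic_on slit_plane"
    unfolding hankel_kernel_def
    by (intro holomorphic_intros) (auto simp: slit_plane_minus_1 complex_nonpos_Reals_iff)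
  fix \<epsilon> :: real assume \<epsilon>: "\<epsilon> > 0"
  define c where "c = \<epsilon> ^ m * (\<epsilon> powr Re \<theta> * exp (- pi * \<bar>Im \<theta>\<bar>))"
  have c: "c > 0" using \<epsilon> by (simp add: c_def)
  have "norm (hankel_kernel \<rho> m \<theta> z) \<le> 1 / c * exp (\<rho> * Re z)" if z: "\<epsilon> \<le> \<bar>Im z\<bar>" for z
  proof -
    have nz: "norm z \<ge> \<epsilon>" "norm (z - 1) \<ge> \<epsilon>"
      using z abs_Im_le_cmod[of z] abs_Im_le_cmod[of "z - 1"] by auto
    then have "z - 1 \<noteq> 0" using \<epsilon> by auto
    have "c \<le> norm z ^ m * norm ((z - 1) powr \<theta>)"
      unfolding c_def
    proof (intro mult_mono power_mono)
      have "\<epsilon> powr Re \<theta> * exp (- pi * \<bar>Im \<theta>\<bar>) \<le> norm (z - 1) powr Re \<theta> * exp (- pi * \<bar>Im \<theta>\<bar>)"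
        using nz \<epsilon> assms by (intro mult_right_mono powr_mono2) auto
      also have "\<dots> \<le> norm ((z - 1) powr \<theta>)" by (rule norm_powr_ge) fact
      finally show "\<epsilon> powr Re \<theta> * exp (- pi * \<bar>Im \<theta>\<bar>) \<le> norm ((z - 1) powr \<theta>)" .
    qed (use nz \<epsilon> in auto)
    then have "exp (\<rho> * Re z) / (norm z ^ m * norm ((z - 1) powr \<theta>)) \<le> exp (\<rho> * Re z) / c"
      using c by (intro divide_left_mono) (auto intro!: mult_pos_pos)
    then show ?thesis
      by (simp add: hankel_kernel_def norm_divide norm_mult norm_power norm_exp_eq_Re)
  qed
  then show "\<exists>C\<ge>0. \<forall>z. \<epsilon> \<le> \<bar>Im z\<bar> \<longrightarrow> norm (hankel_kernel \<rho> m \<theta> z) \<le> C * exp (\<rho> * Re z)"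
    using c by (intro exI[of _ "1 / c"]) auto
qed

text \<open>Insert z = 1 + (z - 1) as a numerator over one more power of z.\<close>

lemma hankel_kernel_diff:
  assumes "z \<in> slit_plane" "z \<noteq> 0"
  shows "hankel_kernel \<rho> m (\<theta> + 1) z = hankel_kernel \<rho> (Suc m) (\<theta> + 1) z + hankel_kernel \<rho> (Suc m) \<theta> z"
proof -
  have "z - 1 \<noteq> 0" using assms by (auto simp: mem_slit_plane)
  then have p: "(z - 1) powr (\<theta> + 1) = (z - 1) powr \<theta> * (z - 1)" by (simp add: powr_add)
  have alg: "e * (i * j) = e * (u * (i * j)) + e * (u * i)" if "j = u * j + u" for e i j u :: complex
    using that by algebra
  have "inverse (z - 1) = inverse z * inverse (z - 1) + inverse z"
    using assms \<open>z - 1 \<noteq> 0\<close> by (simp add: divide_simps)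
  from alg[OF this, of "exp (of_real \<rho> * z)" "inverse (z ^ m) * inverse ((z - 1) powr \<theta>)"]
  show ?thesis
    unfolding hankel_kernel_def divide_inverse p power_Suc inverse_mult_distrib by (simp only: mult.assoc)
qed

lemma hankel_kernel_deriv:
  assumes "z \<in> slit_plane"
  shows "(hankel_kernel \<rho> m \<theta> has_field_derivative
     of_real \<rho> * hankel_kernel \<rho> m \<theta> z + (- of_nat m * hankel_kernel \<rho> (Suc m) \<theta> z + - \<theta> * hankel_kernel \<rho> m (\<theta> + 1) z)) (at z)"
proof -
  have z: "z - 1 \<notin> \<real>\<^sub>\<le>\<^sub>0" "z \<noteq> 0" "z \<noteq> 1" using assms by (auto simp: slit_plane_minus_1)
  have eq: "hankel_kernel \<rho> m \<theta> = (\<lambda>z. exp (of_real \<rho> * z) * ((z - 1) powr (- \<theta>) * inverse z ^ m))" for m \<theta>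
    by (simp add: fun_eq_iff hankel_kernel_def powr_minus divide_inverse power_inverse mult_ac)
  have 1: "((\<lambda>z. exp (of_real \<rho> * z)) has_field_derivative of_real \<rho> * exp (of_real \<rho> * z)) (at z)"
    by (auto intro!: derivative_eq_intros)
  have "((\<lambda>z. (z - 1) powr (- \<theta>)) has_field_derivative (- \<theta> * (z - 1) powr (- \<theta> - 1)) * 1) (at z)"
    by (rule DERIV_chain2[where g = "\<lambda>z. z - 1", OF has_field_derivative_powr])
      (use z in \<open>auto intro!: derivative_eq_intros\<close>)
  then have 2: "((\<lambda>z. (z - 1) powr (- \<theta>)) has_field_derivative - \<theta> * (z - 1) powr (- (\<theta> + 1))) (at z)"
    by simp
  have 3: "((\<lambda>z. inverse z ^ m) has_field_derivative - of_nat m * inverse z ^ Suc m) (at z)"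
    by (rule DERIV_cong[OF DERIV_power[OF DERIV_inverse[OF z(2)]]])
      (cases m; simp add: algebra_simps power2_eq_square)
  show ?thesis
    unfolding eq by (rule DERIV_cong[OF DERIV_mult[OF 1 DERIV_mult[OF 2 3]]]) (simp add: algebra_simps)
qed

section \<open>A power series for the lower incomplete Gamma function\<close>

text \<open>At \<open>a = 0\<close> the term \<open>m = 0\<close> is a division by zero and drops out, so the series is then the
  entire part of the exponential integral.\<close>

definition exp_moment :: "complex \<Rightarrow> complex \<Rightarrow> complex" where
  "exp_moment a w = (\<Sum>m. 1 / (fact m * (of_nat m + a)) * w ^ m)"

text \<open>The operator w d/dw + a multiplies the coefficient of w^m by m + a and so cancels the
  denominator. What remains is the exponential series, without its constant term if a = 0.\<close>

lemma exp_moment_deriv: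
  assumes a: "Re a \<ge> 0"
  obtains D where "(exp_moment a has_field_derivative D) (at w)"
    "w * D + a * exp_moment a w = exp w - (if a = 0 then 1 else 0)"
proof -
  define c where "c m = 1 / (fact m * (of_nat m + a))" for m
  have nz: "of_nat m + a \<noteq> 0" if "m > 0 \<or> a \<noteq> 0" for m
    using that a by (cases "m > 0") (auto simp: complex_eq_iff)
  have summ: "summable (\<lambda>m. c m * y ^ m)" for y
  proof (rule summable_comparison_test_ev)
    show "summable (\<lambda>m. norm y ^ m / fact m)"
      using summable_exp_generic[of "norm y"] by (simp add: field_simps)
    have "norm (c m * y ^ m) \<le> norm y ^ m / fact m" if "m \<ge> 1" for m
    proof -
      have "1 \<le> real m + Re a" using that a by simp
      also have "\<dots> \<le> norm (of_nat m + a)" using complex_Re_le_cmod[of "of_nat m + a"] by simp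
      finally have "norm y ^ m / (fact m * norm (of_nat m + a)) \<le> norm y ^ m / (fact m * 1)"
        by (intro divide_left_mono mult_left_mono mult_pos_pos) auto
      then show ?thesis by (simp add: c_def norm_mult norm_divide norm_power)
    qed
    then show "\<forall>\<^sub>F m in sequentially. norm (c m * y ^ m) \<le> norm y ^ m / fact m"
      by (rule eventually_sequentiallyI)
  qed
  let ?D = "\<Sum>m. diffs c m * w ^ m"
  have eq: "exp_moment a = (\<lambda>w. \<Sum>m. c m * w ^ m)"
    by (simp add: fun_eq_iff exp_moment_def c_def)
  have D: "(exp_moment a has_field_derivative ?D) (at w)"
    unfolding eq by (rule termdiffs_strong_converges_everywhere[OF summ])
  have "summable (\<lambda>m. diffs c m * w ^ m)"
    by (rule termdiff_converges_all) (rule summ)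
  then have "(\<lambda>m. w * (diffs c m * w ^ m)) sums (w * ?D)"
    by (intro sums_mult summable_sums)
  also have "(\<lambda>m. w * (diffs c m * w ^ m)) = (\<lambda>m. of_nat (Suc m) * c (Suc m) * w ^ Suc m)"
    by (simp add: fun_eq_iff diffs_def mult_ac)
  finally have "(\<lambda>m. of_nat m * c m * w ^ m) sums (w * ?D)"
    by (subst (asm) sums_Suc_iff) simp
  from sums_add[OF this sums_mult[OF summable_sums[OF summ[of w]], of a]]
  have 1: "(\<lambda>m. of_nat m * c m * w ^ m + a * (c m * w ^ m)) sums (w * ?D + a * exp_moment a w)"
    by (simp add: eq)
  have "(\<lambda>m. w ^ m / fact m) sums exp w"
    using exp_converges[of w] by (simp add: scaleR_conv_of_real field_simps)
  moreover have "(\<lambda>m. if m = 0 then (if a = 0 then 1 else 0 :: complex) else 0) sums (if a = 0 then 1 else 0)"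
    by (rule sums_single)
  ultimately have "(\<lambda>m. w ^ m / fact m - (if m = 0 then (if a = 0 then 1 else 0) else 0)) sums (exp w - (if a = 0 then 1 else 0))"
    by (rule sums_diff)
  also have "(\<lambda>m. w ^ m / fact m - (if m = 0 then (if a = 0 then 1 else 0) else 0)) =
      (\<lambda>m. of_nat m * c m * w ^ m + a * (c m * w ^ m))"
  proof
    fix m
    have "of_nat m * c m * w ^ m + a * (c m * w ^ m) = (of_nat m + a) * c m * w ^ m"
      by (simp add: algebra_simps)
    also have "(of_nat m + a) * c m = (if m = 0 \<and> a = 0 then 0 else 1 / fact m)"
      using nz[of m] by (auto simp: c_def)
    finally show "w ^ m / fact m - (if m = 0 then (if a = 0 then 1 else 0) else 0) =
        of_nat m * c m * w ^ m + a * (c m * w ^ m)" by auto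
  qed
  finally show ?thesis using that D 1 sums_unique2 by blast
qed

text \<open>\<open>x powr a * exp_moment a (- x)\<close> is the lower incomplete Gamma function.\<close>

lemma exp_moment_tendsto_Gamma:
  fixes X :: "nat \<Rightarrow> real"
  assumes a: "Re a > 0"
    and X: "incseq X" "\<And>n. X n \<ge> 0" "\<And>x. \<exists>n. x \<le> X n"
  shows "(\<lambda>n. of_real (X n) powr a * exp_moment a (- of_real (X n))) \<longlonglongrightarrow> Gamma a"
proof -
  define f where "f t = of_real t powr (a - 1) / of_real (exp t)" for t :: real
  define F where "F t = of_real t powr a * exp_moment a (- of_real t)" for t :: real
  have a0: "a \<noteq> 0" using a by auto
  have f_int: "set_integrable lebesgue {0<..} f"
    using absolutely_integrable_Gamma_integral'[OF a] unfolding f_def .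
  \<comment> \<open>Re a > 0 makes \<open>F\<close> continuous at 0 with value 0; differentiability
    is used in the open interval only, as \<open>f\<close> may be singular at 0.\<close>
  have "(f has_integral F (X n) - F 0) {0..X n}" for n
  proof (rule fundamental_theorem_of_calculus_interior)
    have E: "continuous_on UNIV (exp_moment a)"
    proof (rule continuous_at_imp_continuous_on, safe)
      fix w
      obtain D where "(exp_moment a has_field_derivative D) (at w)"
        using exp_moment_deriv[of a w] a by auto
      then show "isCont (exp_moment a) w" by (rule DERIV_isCont)
    qed
    show "continuous_on {0..X n} F"
      unfolding F_def
      by (intro continuous_on_mult continuous_on_compose2[OF E] continuous_on_powr_complex)
        (use a in \<open>auto intro!: continuous_intros\<close>)
    fix t assume t: "t \<in> {0<..<X n}"
    obtain D where D: "(exp_moment a has_field_derivative D) (at (- of_real t))"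
      "- of_real t * D + a * exp_moment a (- of_real t) = exp (- of_real t)"
      using exp_moment_deriv[of a "- of_real t"] a a0 by auto
    have "((\<lambda>z. exp_moment a (- z)) has_field_derivative D * (- 1)) (at (complex_of_real t))"
      by (rule DERIV_chain2[where g = "\<lambda>z. - z"]) (use D(1) in \<open>auto intro!: derivative_eq_intros\<close>)
    then have "((\<lambda>z. z powr a * exp_moment a (- z)) has_field_derivative
        (of_real t powr (a - 1) * (a * exp_moment a (- of_real t)) - of_real t powr a * D)) (at (of_real t))"
      using t by (auto intro!: derivative_eq_intros simp: algebra_simps)
    also have "of_real t powr (a - 1) * (a * exp_moment a (- of_real t)) - of_real t powr a * D =
       of_real t powr (a - 1) * (- of_real t * D + a * exp_moment a (- of_real t))"
      using t by (simp add: powr_diff field_simps)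
    also have "\<dots> = f t"
      unfolding D(2) f_def by (simp add: exp_minus exp_of_real divide_inverse flip: of_real_minus)
    finally show "(F has_vector_derivative f t) (at t)"
      unfolding F_def by (rule has_vector_derivative_real_field)
  qed (use X(2) in auto)
  then have int: "integral {0..X n} f = F (X n)" for n
    using a0 by (simp add: integral_unique F_def)
  have U: "(\<Union>n. {0<..X n}) = {0<..}"
    using X(3) by auto
  have "(\<lambda>n. LINT t:{0<..X n}|lebesgue. f t) \<longlonglongrightarrow> (LINT t:{0<..}|lebesgue. f t)"
  proof -
    have "incseq (\<lambda>n. {0<..X n})" using X(1) unfolding incseq_def by (auto 0 0) (meson order_trans)
    from set_integral_cont_up[OF _ this, of lebesgue f] f_int show ?thesis unfolding U by auto
  qed
  moreover have "(LINT t:{0<..}|lebesgue. f t) = Gamma a"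
    using set_lebesgue_integral_eq_integral(2)[OF f_int] Gamma_integral_complex'[OF a]
    unfolding f_def by (simp add: integral_unique)
  moreover have "(LINT t:{0<..X n}|lebesgue. f t) = F (X n)" for n
  proof -
    have "(LINT t:{0<..X n}|lebesgue. f t) = integral {0<..X n} f"
      by (rule set_lebesgue_integral_eq_integral(2)[OF set_integrable_subset[OF f_int]]) auto
    also have "\<dots> = integral {0..X n} f"
      by (rule integral_subset_negligible) (auto intro: negligible_subset[of "{0}"])
    finally show ?thesis by (simp add: int)
  qed
  ultimately show ?thesis by (simp add: F_def)
qed

section \<open>Hankel's formula for the reciprocal Gamma function\<close>

text \<open>For \<open>a = 0\<close> the logarithm takes the place of \<open>w powr a / a\<close>, the term dropped from the series.\<close>

definition gamma_primitive :: "complex \<Rightarrow> complex \<Rightarrow> complex \<Rightarrow> complex" where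
  "gamma_primitive a c w =
     (if a = 0 then Ln w + exp_moment 0 (c * w) else w powr a * exp_moment a (c * w))"

text \<open>The equation of \<open>exp_moment_deriv\<close> cancels everything but the exponential.
  At a = 0 the derivative 1/w of the logarithm restores the missing constant term.\<close>

lemma gamma_primitive_deriv:
  assumes a: "Re a \<ge> 0" and w: "w \<notin> \<real>\<^sub>\<le>\<^sub>0"
  shows "(gamma_primitive a c has_field_derivative exp (c * w) * w powr (a - 1)) (at w)"
proof -
  have w0: "w \<noteq> 0" using w by auto
  obtain D where D: "(exp_moment a has_field_derivative D) (at (c * w))"
    "c * w * D + a * exp_moment a (c * w) = exp (c * w) - (if a = 0 then 1 else 0)"
    using exp_moment_deriv[OF a] by blast
  have E: "((\<lambda>w. exp_moment a (c * w)) has_field_derivative D * c) (at w)"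
    by (rule DERIV_chain2[where g = "\<lambda>w. c * w", OF D(1)]) (auto intro!: derivative_eq_intros)
  have Dc: "D * c = (exp (c * w) - (if a = 0 then 1 else 0) - a * exp_moment a (c * w)) / w"
    using w0 unfolding D(2)[symmetric] by simp
  show ?thesis
  proof (cases "a = 0")
    case True
    have "((\<lambda>w. Ln w + exp_moment 0 (c * w)) has_field_derivative inverse w + D * c) (at w)"
      using E True by (intro DERIV_add has_field_derivative_Ln[OF w]) simp
    moreover have "inverse w + D * c = exp (c * w) * w powr (a - 1)"
      using w0 unfolding Dc by (simp add: True powr_minus divide_simps)
    moreover have "gamma_primitive a c = (\<lambda>w. Ln w + exp_moment 0 (c * w))"
      using True by (simp add: fun_eq_iff gamma_primitive_def)
    ultimately show ?thesis by simp
  next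
    case False
    have "((\<lambda>w. w powr a * exp_moment a (c * w)) has_field_derivative
        (a * w powr (a - 1)) * exp_moment a (c * w) + D * c * w powr a) (at w)"
      by (rule DERIV_mult[OF has_field_derivative_powr[OF w] E])
    moreover have "(a * w powr (a - 1)) * exp_moment a (c * w) + D * c * w powr a = exp (c * w) * w powr (a - 1)"
      using w0 False unfolding Dc by (simp add: powr_diff field_simps)
    moreover have "gamma_primitive a c = (\<lambda>w. w powr a * exp_moment a (c * w))"
      using False by (simp add: fun_eq_iff gamma_primitive_def)
    ultimately show ?thesis by simp
  qed
qed

lemma hankel_integral_cong:
  assumes g: "hankel_middle \<epsilon> g" and eq: "\<And>z. z \<in> slit_plane \<Longrightarrow> f z = h z"
  shows "hankel_integral \<epsilon> g f = hankel_integral \<epsilon> g h"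
proof -
  have \<epsilon>: "\<epsilon> > 0" using g by (simp add: hankel_middle_def)
  have "f (Complex x y) = h (Complex x y)" if "y \<noteq> 0" for x y
    using that by (intro eq) (simp add: mem_slit_plane)
  moreover have "contour_integral g f = contour_integral g h"
    by (rule contour_integral_cong) (use eq hankel_middle_slit_plane[OF g] in auto)
  ultimately show ?thesis using \<epsilon> unfolding hankel_integral_def by simp
qed

context
  fixes \<rho> :: real
  assumes \<rho>: "\<rho> > 0"
begin

text \<open>The derivative of the kernel, given by \<open>hankel_kernel_deriv\<close>, integrates to
  0.\<close>

lemma hankel_kernel_by_parts:
  assumes "Re \<theta> \<ge> 0" and g: "hankel_middle \<epsilon> g"
  shows "of_real \<rho> * hankel_integral \<epsilon> g (hankel_kernel \<rho> m \<theta>) =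
    of_nat m * hankel_integral \<epsilon> g (hankel_kernel \<rho> (Suc m) \<theta>)
    + \<theta> * hankel_integral \<epsilon> g (hankel_kernel \<rho> m (\<theta> + 1))"
proof -
  have adm: "hankel_admissible \<rho> (hankel_kernel \<rho> m \<theta>)" "hankel_admissible \<rho> (hankel_kernel \<rho> (Suc m) \<theta>)"
    "hankel_admissible \<rho> (hankel_kernel \<rho> m (\<theta> + 1))"
    using assms by (auto intro!: hankel_kernel_admissible)
  let ?d = "\<lambda>z. of_real \<rho> * hankel_kernel \<rho> m \<theta> z +
      (- of_nat m * hankel_kernel \<rho> (Suc m) \<theta> z + - \<theta> * hankel_kernel \<rho> m (\<theta> + 1) z)"
  have "hankel_integral \<epsilon> g ?d = 0"
    by (rule hankel_integral_derivative[OF \<rho> _ adm(1) g hankel_kernel_deriv])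
      (intro hankel_admissible_add hankel_admissible_cmult adm)
  moreover have "hankel_integral \<epsilon> g ?d =
      of_real \<rho> * hankel_integral \<epsilon> g (hankel_kernel \<rho> m \<theta>) +
      (- of_nat m * hankel_integral \<epsilon> g (hankel_kernel \<rho> (Suc m) \<theta>) +
       - \<theta> * hankel_integral \<epsilon> g (hankel_kernel \<rho> m (\<theta> + 1)))"
    by (subst hankel_integral_add[OF \<rho> _ _ g] hankel_integral_cmult[OF \<rho> _ g],
        (intro hankel_admissible_add hankel_admissible_cmult adm)+)+ simp
  ultimately show ?thesis by (simp add: algebra_simps)
qed

lemma hankel_kernel_shift:
  assumes "Re \<theta> \<ge> 0" and g: "hankel_middle \<epsilon> g"
  shows "hankel_integral \<epsilon> g (hankel_kernel \<rho> m (\<theta> + 1)) =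
    hankel_integral \<epsilon> g (hankel_kernel \<rho> (Suc m) (\<theta> + 1)) + hankel_integral \<epsilon> g (hankel_kernel \<rho> (Suc m) \<theta>)"
proof -
  have "hankel_integral \<epsilon> g (hankel_kernel \<rho> m (\<theta> + 1)) =
        hankel_integral \<epsilon> g (\<lambda>z. hankel_kernel \<rho> (Suc m) (\<theta> + 1) z + hankel_kernel \<rho> (Suc m) \<theta> z)"
    by (intro hankel_integral_cong[OF g] hankel_kernel_diff) (auto simp: mem_slit_plane)
  also have "\<dots> = hankel_integral \<epsilon> g (hankel_kernel \<rho> (Suc m) (\<theta> + 1)) + hankel_integral \<epsilon> g (hankel_kernel \<rho> (Suc m) \<theta>)"
    by (intro hankel_integral_add[OF \<rho>] g hankel_kernel_admissible) (use assms in auto)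
  finally show ?thesis .
qed

text \<open>Far to the right exp(-\<rho>z) decays, so the primitive behaves at every height as on
  the real axis. The abscissa \<open>Suc n\<close> is the distance from 1 to -n.\<close>

lemma gamma_primitive_vertical:
  assumes "0 \<le> Re \<theta>" "Re \<theta> \<le> 1"
  shows "(\<lambda>n. gamma_primitive (1 - \<theta>) (- of_real \<rho>) (Complex (real (Suc n)) y)
     - gamma_primitive (1 - \<theta>) (- of_real \<rho>) (Complex (real (Suc n)) 0)) \<longlonglongrightarrow> 0"
proof (rule tendsto_vertical_difference[OF _ _ exp_neg_tendsto_0[OF \<rho>, of "exp (pi * \<bar>Im \<theta>\<bar>)"]])
  fix n z assume z: "Re z = real (Suc n)"
  then have nz: "z \<notin> \<real>\<^sub>\<le>\<^sub>0" "z \<noteq> 0" by (auto simp: complex_nonpos_Reals_iff)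
  show "(gamma_primitive (1 - \<theta>) (- of_real \<rho>) has_field_derivative exp (- of_real \<rho> * z) * z powr (- \<theta>)) (at z)"
    using gamma_primitive_deriv[of "1 - \<theta>" z "- of_real \<rho>"] assms nz by simp
  have "1 \<le> norm z" using complex_Re_le_cmod[of z] z by simp
  then have "1 * exp (- pi * \<bar>Im \<theta>\<bar>) \<le> norm z powr Re \<theta> * exp (- pi * \<bar>Im \<theta>\<bar>)"
    using assms by (intro mult_right_mono) (auto simp: ge_one_powr_ge_zero)
  also have "\<dots> \<le> norm (z powr \<theta>)" by (rule norm_powr_ge) (use nz in auto)
  finally have "1 / norm (z powr \<theta>) \<le> 1 / exp (- pi * \<bar>Im \<theta>\<bar>)"
    by (intro divide_left_mono) (auto simp: nz)
  then have 1: "norm (z powr (- \<theta>)) \<le> exp (pi * \<bar>Im \<theta>\<bar>)"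
    by (simp add: powr_minus norm_inverse norm_divide exp_minus inverse_eq_divide)
  have "norm (exp (- of_real \<rho> * z)) \<le> exp (- (\<rho> * real n))"
    using \<rho> z by (simp add: norm_exp_eq_Re)
  from mult_mono[OF this 1] show "norm (exp (- of_real \<rho> * z) * z powr (- \<theta>)) \<le> exp (pi * \<bar>Im \<theta>\<bar>) * exp (- (\<rho> * real n))"
    by (simp add: norm_mult mult.commute)
qed

text \<open>Seen from 1, the far ends of the contour are -(n + 1) \<plusminus> i\<epsilon>. As
  negatives of points of the right half plane they let \<open>Ln_minus\<close> exhibit the jump
  across the slit. The factor exp(\<rho>) comes from recentring the exponential at 1.\<close>

lemma gamma_primitive_hankel:
  assumes \<theta>: "0 \<le> Re \<theta>" "Re \<theta> \<le> 1" and g: "hankel_middle \<epsilon> g"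
  shows "(\<lambda>n. of_real (exp \<rho>) * (gamma_primitive (1 - \<theta>) (of_real \<rho>) (- Complex (real (Suc n)) (- \<epsilon>))
     - gamma_primitive (1 - \<theta>) (of_real \<rho>) (- Complex (real (Suc n)) \<epsilon>)))
     \<longlonglongrightarrow> hankel_integral \<epsilon> g (hankel_kernel \<rho> 0 \<theta>)"
proof -
  define \<Phi> where "\<Phi> z = of_real (exp \<rho>) * gamma_primitive (1 - \<theta>) (of_real \<rho>) (z - 1)" for z
  have "(\<Phi> has_field_derivative hankel_kernel \<rho> 0 \<theta> z) (at z)" if "z \<in> slit_plane" for z
  proof -
    have z: "z - 1 \<notin> \<real>\<^sub>\<le>\<^sub>0" using that by (simp add: slit_plane_minus_1)
    have "((\<lambda>z. gamma_primitive (1 - \<theta>) (of_real \<rho>) (z - 1)) has_field_derivative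
        (exp (of_real \<rho> * (z - 1)) * (z - 1) powr (1 - \<theta> - 1)) * 1) (at z)"
      by (rule DERIV_chain2[where g = "\<lambda>z. z - 1", OF gamma_primitive_deriv])
        (use \<theta> z in \<open>auto intro!: derivative_eq_intros\<close>)
    moreover have e: "exp (of_real \<rho> * z) = of_real (exp \<rho>) * exp (of_real \<rho> * (z - 1))"
      by (simp add: exp_of_real[symmetric] exp_add[symmetric] algebra_simps)
    ultimately show ?thesis
      using DERIV_cmult[of _ _ z UNIV "of_real (exp \<rho>)"]
      unfolding \<Phi>_def hankel_kernel_def e by (simp add: powr_minus divide_inverse mult.assoc)
  qed
  from hankel_integral_primitive[OF \<rho> hankel_kernel_admissible[OF \<theta>(1)] g this]
  have "(\<lambda>n. \<Phi> (Complex (- real n) \<epsilon>) - \<Phi> (Complex (- real n) (- \<epsilon>))) \<longlonglongrightarrow> hankel_integral \<epsilon> g (hankel_kernel \<rho> 0 \<theta>)" .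
  moreover have "Complex (- real n) y - 1 = - Complex (real (Suc n)) (- y)" for n y
    by (simp add: complex_eq_iff)
  ultimately show ?thesis
    unfolding \<Phi>_def by (simp add: right_diff_distrib del: of_nat_Suc)
qed

text \<open>The argument of \<open>hankel_kernel_0_strip\<close> fails at \<theta> = 1, where
  Gamma(1 - \<theta>) has a pole. Here the jump 2\<pi>i of the logarithm is the whole contribution;
  the rest of the primitive gives a null sequence.\<close>

lemma hankel_kernel_0_at_1:
  assumes g: "hankel_middle \<epsilon> g"
  shows "hankel_integral \<epsilon> g (hankel_kernel \<rho> 0 1) = 2 * of_real pi * \<i> * of_real (exp \<rho>)"
proof -
  have \<epsilon>: "\<epsilon> > 0" using g by (simp add: hankel_middle_def)
  define \<Psi> where "\<Psi> n y = gamma_primitive 0 (- of_real \<rho>) (Complex (real (Suc n)) y)" for n y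
  have V: "(\<lambda>n. \<Psi> n y - \<Psi> n 0) \<longlonglongrightarrow> 0" for y
    using gamma_primitive_vertical[of 1 y] by (simp add: \<Psi>_def del: of_nat_Suc)
  have 1: "gamma_primitive 0 (of_real \<rho>) (- Complex (real (Suc n)) (- \<epsilon>)) = \<Psi> n (- \<epsilon>) + \<i> * of_real pi"
   and 2: "gamma_primitive 0 (of_real \<rho>) (- Complex (real (Suc n)) \<epsilon>) = \<Psi> n \<epsilon> - \<i> * of_real pi" for n
    using \<epsilon> by (simp_all add: gamma_primitive_def \<Psi>_def Ln_minus complex_eq_iff del: of_nat_Suc)
  have "(\<lambda>n. of_real (exp \<rho>) * (((\<Psi> n (- \<epsilon>) - \<Psi> n 0) - (\<Psi> n \<epsilon> - \<Psi> n 0)) + 2 * of_real pi * \<i>))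
      \<longlonglongrightarrow> of_real (exp \<rho>) * ((0 - 0) + 2 * of_real pi * \<i>)"
    by (intro tendsto_intros V)
  moreover have "(\<lambda>n. of_real (exp \<rho>) * (((\<Psi> n (- \<epsilon>) - \<Psi> n 0) - (\<Psi> n \<epsilon> - \<Psi> n 0)) + 2 * of_real pi * \<i>))
      \<longlonglongrightarrow> hankel_integral \<epsilon> g (hankel_kernel \<rho> 0 1)"
    using gamma_primitive_hankel[of 1, OF _ _ g] by (simp add: 1 2 algebra_simps del: of_nat_Suc)
  ultimately show ?thesis
    using LIMSEQ_unique by (fastforce simp: mult_ac)
qed

text \<open>On the two sides of the slit the primitive differs by the factors \<open>exp (\<plusminus>\<pi>\<i>(1 - \<theta>))\<close>; the
  reflection formula turns the resulting sine into \<open>1 / Gamma \<theta>\<close>.\<close>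

lemma hankel_kernel_0_strip:
  assumes \<theta>: "0 \<le> Re \<theta>" "Re \<theta> < 1" and g: "hankel_middle \<epsilon> g"
  shows "hankel_integral \<epsilon> g (hankel_kernel \<rho> 0 \<theta>) =
    2 * of_real pi * \<i> * of_real (exp \<rho>) * of_real \<rho> powr (\<theta> - 1) * rGamma \<theta>"
proof -
  have \<epsilon>: "\<epsilon> > 0" using g by (simp add: hankel_middle_def)
  define a where "a = 1 - \<theta>"
  have a: "Re a > 0" "a \<noteq> 0" using \<theta> by (auto simp: a_def complex_eq_iff)
  define \<Psi> where "\<Psi> n y = gamma_primitive a (- of_real \<rho>) (Complex (real (Suc n)) y)" for n y
  define L where "L = of_real \<rho> powr (- a) * Gamma a"
  have V: "(\<lambda>n. \<Psi> n y - \<Psi> n 0) \<longlonglongrightarrow> 0" for y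
    using gamma_primitive_vertical[of \<theta> y] \<theta> by (simp add: \<Psi>_def a_def del: of_nat_Suc)
  have 1: "gamma_primitive a (of_real \<rho>) (- Complex (real (Suc n)) (- \<epsilon>)) = exp (\<i> * of_real pi * a) * \<Psi> n (- \<epsilon>)"
   and 2: "gamma_primitive a (of_real \<rho>) (- Complex (real (Suc n)) \<epsilon>) = exp (- (\<i> * of_real pi * a)) * \<Psi> n \<epsilon>" for n
    using \<epsilon> a by (simp_all add: gamma_primitive_def \<Psi>_def powr_def Ln_minus complex_eq_iff[of _ 0] exp_add exp_diff exp_minus
        distrib_left right_diff_distrib divide_inverse mult_ac del: of_nat_Suc)
  \<comment> \<open>On the real axis the primitive is \<open>\<rho> powr (- a)\<close> times the
    lower incomplete Gamma function at \<rho>(n + 1).\<close>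
  have \<Psi>0: "(\<lambda>n. \<Psi> n 0) \<longlonglongrightarrow> L"
  proof -
    have "(\<lambda>n. of_real \<rho> powr (- a) * (of_real (\<rho> * real (Suc n)) powr a * exp_moment a (- of_real (\<rho> * real (Suc n))))) \<longlonglongrightarrow> L"
      unfolding L_def
    proof (intro tendsto_mult tendsto_const exp_moment_tendsto_Gamma a)
      show "incseq (\<lambda>n. \<rho> * real (Suc n))" using \<rho> by (auto simp: incseq_def)
      show "0 \<le> \<rho> * real (Suc n)" for n using \<rho> by simp
      fix x
      obtain n where "x / \<rho> \<le> real n" using real_arch_simple by blast
      then have "x \<le> \<rho> * real (Suc n)" using \<rho> by (simp add: field_simps)
      then show "\<exists>n. x \<le> \<rho> * real (Suc n)" by blast
    qed
    moreover have "of_real \<rho> powr (- a) * (of_real (\<rho> * real (Suc n)) powr a * exp_moment a (- of_real (\<rho> * real (Suc n)))) = \<Psi> n 0" for n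
    proof -
      have "complex_of_real (\<rho> * real (Suc n)) powr a = of_real \<rho> powr a * of_real (real (Suc n)) powr a"
        using \<rho> by (simp only: of_real_mult) (rule powr_times_real, auto)
      moreover have "Complex (real (Suc n)) 0 = of_real (real (Suc n))" by (simp add: complex_eq_iff)
      ultimately show ?thesis
        using \<rho> a by (simp add: \<Psi>_def gamma_primitive_def powr_minus field_simps del: of_nat_Suc)
    qed
    ultimately show ?thesis by simp
  qed
  have \<Psi>: "(\<lambda>n. \<Psi> n y) \<longlonglongrightarrow> L" for y
    using tendsto_add[OF V[of y] \<Psi>0] by simp
  have "(\<lambda>n. of_real (exp \<rho>) * (exp (\<i> * of_real pi * a) * \<Psi> n (- \<epsilon>) - exp (- (\<i> * of_real pi * a)) * \<Psi> n \<epsilon>))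
     \<longlonglongrightarrow> of_real (exp \<rho>) * (exp (\<i> * of_real pi * a) * L - exp (- (\<i> * of_real pi * a)) * L)"
    by (intro tendsto_intros \<Psi>)
  moreover have "(\<lambda>n. of_real (exp \<rho>) * (exp (\<i> * of_real pi * a) * \<Psi> n (- \<epsilon>) - exp (- (\<i> * of_real pi * a)) * \<Psi> n \<epsilon>))
     \<longlonglongrightarrow> hankel_integral \<epsilon> g (hankel_kernel \<rho> 0 \<theta>)"
    using gamma_primitive_hankel[of \<theta>, OF _ _ g] \<theta> by (simp add: 1 2 del: of_nat_Suc flip: a_def)
  ultimately have "hankel_integral \<epsilon> g (hankel_kernel \<rho> 0 \<theta>) =
      of_real (exp \<rho>) * (exp (\<i> * of_real pi * a) * L - exp (- (\<i> * of_real pi * a)) * L)"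
    using LIMSEQ_unique by blast
  also have "\<dots> = of_real (exp \<rho>) * (2 * \<i> * sin (of_real pi * a)) * L"
    by (simp add: sin_exp_eq field_simps)
  also have "\<dots> = 2 * of_real pi * \<i> * of_real (exp \<rho>) * of_real \<rho> powr (- a) * (sin (of_real pi * a) / of_real pi * Gamma a)"
    by (simp add: L_def)
  also have "sin (of_real pi * a) / of_real pi * Gamma a = rGamma (1 - a) * (rGamma a * Gamma a)"
    unfolding rGamma_reflection_complex[symmetric] by (simp add: mult_ac)
  also have "rGamma a * Gamma a = 1"
  proof -
    have "a \<notin> \<int>\<^sub>\<le>\<^sub>0" using a(1) by (auto elim!: nonpos_Ints_cases)
    then show ?thesis by (simp add: Gamma_def rGamma_eq_zero_iff)
  qed
  finally show ?thesis by (simp add: a_def)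
qed

text \<open>Induction over unit strips. With H for the integral,
  \<open>hankel_kernel_by_parts\<close> at \<open>m = 0\<close> reads \<rho>H(\<eta>) =
  \<eta>H(\<eta> + 1), matching the functional equation of \<open>rGamma\<close>. At \<eta> = 0 it
  does not determine H(1), so \<theta> = 1 enters separately.\<close>

theorem hankel_kernel_0:
  assumes \<theta>: "0 \<le> Re \<theta>" and g: "hankel_middle \<epsilon> g"
  shows "hankel_integral \<epsilon> g (hankel_kernel \<rho> 0 \<theta>) =
    2 * of_real pi * \<i> * of_real (exp \<rho>) * of_real \<rho> powr (\<theta> - 1) * rGamma \<theta>"
proof -
  have "Re \<theta> < real (Suc n) \<Longrightarrow> ?thesis" for n
    using \<theta>
  proof (induction n arbitrary: \<theta>)
    case 0
    then show ?case using hankel_kernel_0_strip[OF _ _ g] by simp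
  next
    case (Suc n)
    consider "Re \<theta> < 1" | "\<theta> = 1" | "Re \<theta> \<ge> 1" "\<theta> \<noteq> 1" by linarith
    then show ?case
    proof cases
      case 1
      then show ?thesis using hankel_kernel_0_strip[OF _ _ g] Suc.prems by simp
    next
      case 2
      then show ?thesis using hankel_kernel_0_at_1[OF g] \<rho> by simp
    next
      case 3
      define \<eta> where "\<eta> = \<theta> - 1"
      have \<eta>: "Re \<eta> \<ge> 0" "\<eta> \<noteq> 0" "\<theta> = \<eta> + 1" using 3 by (auto simp: \<eta>_def)
      have IH: "hankel_integral \<epsilon> g (hankel_kernel \<rho> 0 \<eta>) =
          2 * of_real pi * \<i> * of_real (exp \<rho>) * of_real \<rho> powr (\<eta> - 1) * rGamma \<eta>"
        using Suc.prems \<eta> by (intro Suc.IH) auto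
      have "\<eta> * hankel_integral \<epsilon> g (hankel_kernel \<rho> 0 \<theta>) = of_real \<rho> * hankel_integral \<epsilon> g (hankel_kernel \<rho> 0 \<eta>)"
        using hankel_kernel_by_parts[OF \<eta>(1) g, of 0] \<eta> by simp
      also have "\<dots> = \<eta> * (2 * of_real pi * \<i> * of_real (exp \<rho>) * of_real \<rho> powr (\<theta> - 1) * rGamma \<theta>)"
        unfolding IH using \<rho> rGamma_plus1[of \<eta>] \<eta> by (simp add: powr_diff)
      finally show ?thesis using \<eta> by simp
    qed
  qed
  moreover obtain n where "Re \<theta> \<le> real n" using real_arch_simple by blast
  then have "Re \<theta> < real (Suc n)" by simp
  ultimately show ?thesis by blast
qed

end

section \<open>The resolvent\<close>

lemma set_integrable_exp_neg:
  fixes c :: real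
  assumes "c > 0"
  shows "set_integrable lborel {0..} (\<lambda>t. exp (- c * t))"
proof -
  have "set_integrable lborel (einterval (ereal (- 1)) \<infinity>) (\<lambda>t. exp (- c * t))"
  proof (rule interval_integral_FTC_nonneg(1)[where F = "\<lambda>t. - (exp (- c * t) / c)" and B = 0
        and A = "- (exp (- c * (- 1)) / c)"])
    show "(((\<lambda>t. - (exp (- c * t) / c)) \<circ> real_of_ereal) \<longlongrightarrow> 0) (at_left \<infinity>)"
      unfolding ereal_tendsto_simps using assms by real_asymp
    show "(((\<lambda>t. - (exp (- c * t) / c)) \<circ> real_of_ereal) \<longlongrightarrow> - (exp (- c * (- 1)) / c)) (at_right (ereal (- 1)))"
      unfolding ereal_tendsto_simps by (intro tendsto_intros) (use assms in auto)
  qed (use assms in \<open>auto intro!: derivative_eq_intros continuous_intros\<close>)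
  then show ?thesis
    by (rule set_integrable_subset) (auto simp: einterval_def)
qed

lemma set_integrable_laplace:
  fixes u :: "real \<Rightarrow> real" and \<theta> :: complex
  assumes "Re \<theta> > 0" "continuous_on {0..} u" "\<And>t. t \<ge> 0 \<Longrightarrow> \<bar>u t\<bar> \<le> 1"
  shows "set_integrable lborel {0..} (\<lambda>t. exp (- \<theta> * of_real t) * of_real (u t))"
proof (rule set_integrable_bound)
  show "set_integrable lborel {0..} (\<lambda>t. exp (- Re \<theta> * t))"
    by (rule set_integrable_exp_neg) (use assms in auto)
  have cont: "continuous_on {0..} (\<lambda>t. exp (- \<theta> * of_real t) * of_real (u t))"
    by (intro continuous_intros assms)
  show "set_borel_measurable lborel {0..} (\<lambda>t. exp (- \<theta> * of_real t) * of_real (u t))"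
    unfolding set_borel_measurable_def
    using borel_measurable_continuous_on_indicator[OF _ cont] by simp
  show "AE t in lborel. t \<in> {0..} \<longrightarrow> norm (exp (- \<theta> * of_real t) * of_real (u t)) \<le> norm (exp (- Re \<theta> * t))"
    by (intro AE_I2) (use assms in \<open>auto simp: norm_mult norm_exp_eq_Re intro!: mult_left_le\<close>)
qed

text \<open>Multiplication by \<open>x = exp (- t)\<close> under the Laplace transform is a unit
  shift of \<theta>; this turns identities in x into contiguity relations.\<close>

lemma exp_laplace_shift:
  fixes \<theta> :: complex
  shows
  "exp (- (\<theta> + 1) * of_real t) = exp (- \<theta> * of_real t) * of_real (exp (- t))"
proof -
  have "- (\<theta> + 1) * of_real t = - \<theta> * of_real t + of_real (- t)" by (simp add: algebra_simps)
  then show ?thesis by (simp only: exp_add exp_of_real)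
qed

context
  fixes \<rho> :: real
  assumes \<rho>: "\<rho> > 0"
begin

text \<open>On the contour through \<open>3 - 2\<i>\<close> and \<open>3 + 2\<i>\<close> one has \<open>norm (z - 1) \<ge> 2\<close>,
  so each unit step of \<open>\<theta>\<close> gains a factor \<open>1 / 2\<close>.\<close>

lemma hankel_kernel_decay:
  assumes \<theta>: "Re \<theta> \<ge> 0" and g: "hankel_middle \<epsilon> g"
  shows "(\<lambda>M. hankel_integral \<epsilon> g (hankel_kernel \<rho> m (\<theta> + of_nat M))) \<longlonglongrightarrow> 0"
proof -
  define p where "p = linepath (Complex 3 (- 2)) (Complex 3 2)"
  define f where "f M = hankel_kernel \<rho> m (\<theta> + of_nat M)" for M
  have p: "path_image p = {z. Re z = 3 \<and> Im z \<in> {-2..2}}"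
    unfolding p_def path_image_linepath
    by (subst closed_segment_same_Re) (auto simp: closed_segment_eq_real_ivl)
  have hp: "hankel_middle 2 p"
    unfolding hankel_middle_def p by (auto simp: p_def)
  have adm: "hankel_admissible \<rho> (f M)" for M
    unfolding f_def by (rule hankel_kernel_admissible) (use \<theta> in auto)
  have le: "norm (f M z) \<le> (1 / 2) ^ M * norm (f 0 z)" if "norm (z - 1) \<ge> 2" for M z
  proof -
    have "z - 1 \<noteq> 0" using that by auto
    then have "f M z = f 0 z / (z - 1) ^ M"
      by (simp add: f_def hankel_kernel_def powr_add powr_nat')
    then have "norm (f M z) = norm (f 0 z) / norm (z - 1) ^ M"
      by (simp add: norm_divide norm_power)
    also have "\<dots> \<le> norm (f 0 z) / 2 ^ M"
      using that by (intro divide_left_mono power_mono mult_pos_pos zero_less_power) auto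
    finally show ?thesis by (simp add: power_divide)
  qed
  have ray: "norm (LINT x:{..a}|lborel. f M (Complex x y)) \<le> (1 / 2) ^ M * (LINT x:{..a}|lborel. norm (f 0 (Complex x y)))"
    if y: "\<bar>y\<bar> = 2" for a y M
  proof -
    have int: "set_integrable lborel {..a} (\<lambda>x. f M (Complex x y))" for M
      by (rule set_integrable_ray[OF \<rho> adm]) (use y in auto)
    have "norm (LINT x:{..a}|lborel. f M (Complex x y)) \<le> (LINT x:{..a}|lborel. norm (f M (Complex x y)))"
      by (rule set_integral_norm_bound[OF int])
    also have "\<dots> \<le> (LINT x:{..a}|lborel. (1 / 2) ^ M * norm (f 0 (Complex x y)))"
    proof (rule set_integral_mono)
      show "norm (f M (Complex x y)) \<le> (1 / 2) ^ M * norm (f 0 (Complex x y))" for x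
        using le[of "Complex x y" M] abs_Im_le_cmod[of "Complex x y - 1"] y by simp
    qed (intro set_integrable_norm int set_integrable_mult_right)+
    finally show ?thesis by simp
  qed
  have "bounded (f 0 ` path_image p)"
    using hankel_middle_slit_plane[OF hp] hankel_admissible_holomorphic[OF adm[of 0]] hp
    by (intro compact_imp_bounded compact_continuous_image compact_path_image valid_path_imp_path)
      (auto simp: hankel_middle_def intro: continuous_on_subset holomorphic_on_imp_continuous_on)
  then obtain B where B: "B > 0" "\<And>z. z \<in> path_image p \<Longrightarrow> norm (f 0 z) \<le> B"
    by (auto simp: bounded_pos)
  have mid: "norm (contour_integral p (f M)) \<le> ((1 / 2) ^ M * B) * norm (Complex 3 2 - Complex 3 (- 2))" for M
    unfolding p_def
  proof (rule contour_integral_bound_linepath)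
    show "f M contour_integrable_on linepath (Complex 3 (- 2)) (Complex 3 2)"
      using contour_integrable_holomorphic_simple[OF hankel_admissible_holomorphic[OF adm[of M]] open_slit_plane, of p]
        hankel_middle_slit_plane[OF hp] by (simp add: p_def)
    fix z assume "z \<in> closed_segment (Complex 3 (- 2)) (Complex 3 2)"
    then have z: "z \<in> path_image p" by (simp add: p_def)
    then have "norm (z - 1) \<ge> 2" using complex_Re_le_cmod[of "z - 1"] by (simp add: p)
    then show "norm (f M z) \<le> (1 / 2) ^ M * B"
      by (rule order_trans[OF le mult_left_mono[OF B(2)[OF z]]]) simp
  qed (use B in auto)
  define C where "C = (LINT x:{..3}|lborel. norm (f 0 (Complex x (- 2)))) + B * norm (Complex 3 2 - Complex 3 (- 2))
     + (LINT x:{..3}|lborel. norm (f 0 (Complex x 2)))"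
  have "norm (hankel_integral 2 p (f M)) \<le> (1 / 2) ^ M * C" for M
  proof -
    have 1: "Re (pathstart p) = 3" "Re (pathfinish p) = 3" by (simp_all add: p_def)
    have "norm (hankel_integral 2 p (f M)) \<le> norm (LINT x:{..3}|lborel. f M (Complex x (- 2)))
        + norm (contour_integral p (f M)) + norm (LINT x:{..3}|lborel. f M (Complex x 2))"
      unfolding hankel_integral_def 1
      by (meson add_mono norm_triangle_ineq norm_triangle_ineq4 order_refl order_trans)
    also have "\<dots> \<le> (1 / 2) ^ M * (LINT x:{..3}|lborel. norm (f 0 (Complex x (- 2)))) +
        ((1 / 2) ^ M * B) * norm (Complex 3 2 - Complex 3 (- 2)) +
        (1 / 2) ^ M * (LINT x:{..3}|lborel. norm (f 0 (Complex x 2)))"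
      by (intro add_mono ray mid) auto
    also have "\<dots> = (1 / 2) ^ M * C" by (simp add: C_def algebra_simps)
    finally show ?thesis .
  qed
  moreover have "(\<lambda>M. (1 / 2) ^ M * C) \<longlonglongrightarrow> 0"
    by (rule tendsto_mult_left_zero) (rule LIMSEQ_power_zero, simp)
  ultimately have "(\<lambda>M. hankel_integral 2 p (f M)) \<longlonglongrightarrow> 0"
    by (rule Lim_null_comparison[OF always_eventually[OF allI]])
  then show ?thesis
    using hankel_integral_indep[OF \<rho> adm g hp] by (simp add: f_def)
qed

section \<open>Laplace transforms of the transition probabilities\<close>

definition mm_laplace :: "nat \<Rightarrow> nat \<Rightarrow> complex \<Rightarrow> complex" where
  "mm_laplace i n \<theta> = (LINT t:{0..}|lborel. exp (- \<theta> * of_real t) * of_real (mm_inf \<rho> (exp (- t)) i n))"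

lemma mm_laplace_integrable:
  assumes "Re \<theta> > 0"
  shows "set_integrable lborel {0..} (\<lambda>t. exp (- \<theta> * of_real t) * of_real (mm_inf \<rho> (exp (- t)) i n))"
proof (rule set_integrable_laplace[OF assms])
  show "continuous_on {0..} (\<lambda>t. mm_inf \<rho> (exp (- t)) i n)"
    by (intro continuous_intros)
  show "\<bar>mm_inf \<rho> (exp (- t)) i n\<bar> \<le> 1" if "t \<ge> 0" for t
    using mm_inf_bounds[of \<rho> "exp (- t)" i n] \<rho> that by simp
qed

lemma mm_laplace_Suc_Suc:
  assumes \<theta>: "Re \<theta> > 0"
  shows "mm_laplace (Suc i) (Suc n) \<theta> =
    mm_laplace i (Suc n) \<theta> - mm_laplace i (Suc n) (\<theta> + 1) + mm_laplace i n (\<theta> + 1)"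
proof -
  have \<theta>1: "Re (\<theta> + 1) > 0" using \<theta> by simp
  have "mm_laplace (Suc i) (Suc n) \<theta> = (LINT t:{0..}|lborel.
      (exp (- \<theta> * of_real t) * of_real (mm_inf \<rho> (exp (- t)) i (Suc n))
      - exp (- (\<theta> + 1) * of_real t) * of_real (mm_inf \<rho> (exp (- t)) i (Suc n)))
      + exp (- (\<theta> + 1) * of_real t) * of_real (mm_inf \<rho> (exp (- t)) i n))"
    unfolding mm_laplace_def exp_laplace_shift
    by (rule set_lebesgue_integral_cong) (auto simp: algebra_simps)
  then show ?thesis
    unfolding mm_laplace_def
    by (simp only: set_integral_add set_integral_diff mm_laplace_integrable[OF \<theta>] mm_laplace_integrable[OF \<theta>1])
qed

text \<open>Consecutive Poisson weights have ratio \<rho>(1 - x)/(n + 1), and the factor x acts as a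
  shift of \<theta>.\<close>

lemma mm_laplace_0_Suc:
  assumes \<theta>: "Re \<theta> > 0"
  shows "of_nat (Suc n) * mm_laplace 0 (Suc n) \<theta> = of_real \<rho> * (mm_laplace 0 n \<theta> - mm_laplace 0 n (\<theta> + 1))"
proof -
  have \<theta>1: "Re (\<theta> + 1) > 0" using \<theta> by simp
  have eq: "real (Suc n) * mm_inf \<rho> x 0 (Suc n) = \<rho> * (mm_inf \<rho> x 0 n - x * mm_inf \<rho> x 0 n)" for x
  proof -
    have "real (Suc n) * mm_inf \<rho> x 0 (Suc n) = \<rho> * (1 - x) * mm_inf \<rho> x 0 n"
      by (simp del: of_nat_Suc)
    also have "\<dots> = \<rho> * (mm_inf \<rho> x 0 n - x * mm_inf \<rho> x 0 n)"
      by (simp add: algebra_simps del: mm_inf.simps)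
    finally show ?thesis .
  qed
  have "of_nat (Suc n) * mm_laplace 0 (Suc n) \<theta> = (LINT t:{0..}|lborel.
      exp (- \<theta> * of_real t) * of_real (real (Suc n) * mm_inf \<rho> (exp (- t)) 0 (Suc n)))"
    unfolding mm_laplace_def set_integral_mult_right[symmetric]
    by (rule set_lebesgue_integral_cong) (auto simp: mult_ac simp del: mm_inf.simps)
  also have "\<dots> = (LINT t:{0..}|lborel. of_real \<rho> *
      (exp (- \<theta> * of_real t) * of_real (mm_inf \<rho> (exp (- t)) 0 n)
      - exp (- (\<theta> + 1) * of_real t) * of_real (mm_inf \<rho> (exp (- t)) 0 n)))"
    unfolding eq exp_laplace_shift
    by (rule set_lebesgue_integral_cong) (auto simp: algebra_simps simp del: mm_inf.simps)
  finally show ?thesis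
    unfolding mm_laplace_def
    by (simp only: set_integral_mult_right set_integral_diff mm_laplace_integrable[OF \<theta>] mm_laplace_integrable[OF \<theta>1])
qed

text \<open>With p(t) the probability of an empty queue started empty, p' = -\<rho> exp(-t) p. Hence
  the left-hand side integrates minus the derivative of exp(-\<theta>t) p(t), and the boundary value
  at 0 supplies the 1.\<close>

lemma mm_laplace_0_0:
  assumes \<theta>: "Re \<theta> > 0"
  shows "\<theta> * mm_laplace 0 0 \<theta> + of_real \<rho> * mm_laplace 0 0 (\<theta> + 1) = 1"
proof -
  have \<theta>1: "Re (\<theta> + 1) > 0" using \<theta> by simp
  define f where "f t = exp (- \<theta> * of_real t) * of_real (mm_inf \<rho> (exp (- t)) 0 0)" for t
  define f' where "f' t = \<theta> * (exp (- \<theta> * of_real t) * of_real (mm_inf \<rho> (exp (- t)) 0 0))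
      + of_real \<rho> * (exp (- (\<theta> + 1) * of_real t) * of_real (mm_inf \<rho> (exp (- t)) 0 0))" for t
  have int: "set_integrable lborel {0..} f'"
    unfolding f'_def
    by (intro set_integral_add(1) set_integrable_mult_right mm_laplace_integrable \<theta> \<theta>1)
  have der: "((\<lambda>t. - f t) has_vector_derivative f' t) (at t)" for t
  proof -
    have "((\<lambda>z. - (exp (- \<theta> * z) * exp (- of_real \<rho> * (1 - exp (- z))))) has_field_derivative
        \<theta> * (exp (- \<theta> * of_real t) * exp (- of_real \<rho> * (1 - exp (- of_real t))))
        + of_real \<rho> * ((exp (- \<theta> * of_real t) * exp (- of_real t)) * exp (- of_real \<rho> * (1 - exp (- of_real t))))) (at (of_real t))"
      by (auto intro!: derivative_eq_intros simp: algebra_simps)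
    moreover have "complex_of_real (mm_inf \<rho> (exp (- t)) 0 0) = exp (- of_real \<rho> * (1 - exp (- of_real t)))" for t
      by (simp add: exp_of_real[symmetric])
    ultimately show ?thesis
      unfolding f_def f'_def exp_laplace_shift
      using has_vector_derivative_real_field[where f = "\<lambda>z. - (exp (- \<theta> * z) * exp (- of_real \<rho> * (1 - exp (- z))))"]
      by (simp add: exp_of_real[symmetric] del: mm_inf.simps)
  qed
  have "(LINT t:{0..real n}|lborel. f' t) = 1 - f (real n)" for n
  proof -
    have "(LINT t:{0..real n}|lborel. f' t) = - f (real n) - - f 0"
      unfolding set_lebesgue_integral_def
    proof (rule integral_FTC_atLeastAtMost)
      show "continuous_on {0..real n} f'"
        unfolding f'_def by (intro continuous_intros)
    qed (auto intro: has_vector_derivative_at_within[OF der])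
    then show ?thesis by (simp add: f_def)
  qed
  moreover have "(\<lambda>n. LINT t:{0..real n}|lborel. f' t) \<longlonglongrightarrow> (LINT t:{0..}|lborel. f' t)"
  proof -
    have U: "(\<Union>n. {0..real n}) = {0..}" by (auto intro: real_arch_simple)
    have "incseq (\<lambda>n. {0..real n})" by (auto simp: incseq_def)
    from set_integral_cont_up[OF _ this, of lborel f'] int show ?thesis unfolding U by auto
  qed
  ultimately have "(\<lambda>n. 1 - f (real n)) \<longlonglongrightarrow> (LINT t:{0..}|lborel. f' t)" by simp
  moreover have "(\<lambda>n. f (real n)) \<longlonglongrightarrow> 0"
  proof (rule Lim_null_comparison)
    show "(\<lambda>n. exp (- Re \<theta> * real n)) \<longlonglongrightarrow> 0" using \<theta> by real_asymp
    show "\<forall>\<^sub>F n in sequentially. norm (f (real n)) \<le> exp (- Re \<theta> * real n)"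
    proof (intro always_eventually allI)
      fix n
      have "\<bar>mm_inf \<rho> (exp (- real n)) 0 0\<bar> \<le> 1" using mm_inf_bounds[of \<rho> "exp (- real n)" 0 0] \<rho> by (simp del: mm_inf.simps)
      then show "norm (f (real n)) \<le> exp (- Re \<theta> * real n)"
        unfolding f_def by (simp add: norm_mult norm_exp_eq_Re del: mm_inf.simps)
    qed
  qed
  then have "(\<lambda>n. 1 - f (real n)) \<longlonglongrightarrow> 1 - 0" by (intro tendsto_intros)
  ultimately have "(LINT t:{0..}|lborel. f' t) = 1" using LIMSEQ_unique by fastforce
  moreover have "(LINT t:{0..}|lborel. f' t) = \<theta> * mm_laplace 0 0 \<theta> + of_real \<rho> * mm_laplace 0 0 (\<theta> + 1)"
    unfolding f'_def mm_laplace_def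
    by (simp only: set_integral_mult_right set_integral_add set_integrable_mult_right
        mm_laplace_integrable[OF \<theta>] mm_laplace_integrable[OF \<theta>1])
  ultimately show ?thesis by simp
qed

text \<open>The bound is uniform in \<open>M\<close>, so in \<open>G_fun_0_eq_laplace\<close> the
  decay can come from the reciprocal Gamma function alone.\<close>

lemma mm_laplace_bound:
  assumes \<theta>: "Re \<theta> > 0"
  shows "norm (mm_laplace i n (\<theta> + of_nat M)) \<le> (LINT t:{0..}|lborel. exp (- Re \<theta> * t))"
proof -
  have \<theta>M: "Re (\<theta> + of_nat M) > 0" using \<theta> by simp
  have "norm (mm_laplace i n (\<theta> + of_nat M)) \<le> (LINT t:{0..}|lborel.
      norm (exp (- (\<theta> + of_nat M) * of_real t) * of_real (mm_inf \<rho> (exp (- t)) i n)))"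
    unfolding mm_laplace_def by (rule set_integral_norm_bound[OF mm_laplace_integrable[OF \<theta>M]])
  also have "\<dots> \<le> (LINT t:{0..}|lborel. exp (- Re \<theta> * t))"
  proof (rule set_integral_mono)
    fix t :: real assume t: "t \<in> {0..}"
    then have "\<bar>mm_inf \<rho> (exp (- t)) i n\<bar> \<le> 1" using mm_inf_bounds[of \<rho> "exp (- t)" i n] \<rho> by simp
    moreover have "exp (- (Re \<theta> + real M) * t) \<le> exp (- Re \<theta> * t)" using t by (simp add: algebra_simps)
    ultimately show "norm (exp (- (\<theta> + of_nat M) * of_real t) * of_real (mm_inf \<rho> (exp (- t)) i n)) \<le> exp (- Re \<theta> * t)"
      using mult_mono[of "exp (- (Re \<theta> + real M) * t)" "exp (- Re \<theta> * t)" "\<bar>mm_inf \<rho> (exp (- t)) i n\<bar>" 1]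
      by (simp add: norm_mult norm_exp_eq_Re)
  qed (use set_integrable_norm[OF mm_laplace_integrable[OF \<theta>M]] set_integrable_exp_neg[OF \<theta>] in auto)
  finally show ?thesis .
qed

lemma rGamma_mult_power_tendsto_0:
  assumes "Re \<theta> > 0"
  shows "(\<lambda>M. of_real \<rho> ^ M * rGamma (\<theta> + of_nat M)) \<longlonglongrightarrow> 0"
proof (rule summable_LIMSEQ_zero)
  \<comment> \<open>From \<open>N\<close> on, |\<theta> + M| \<ge> 2\<rho>, so the functional
    equation of \<open>rGamma\<close> yields the ratio 1/2.\<close>
  obtain N where N: "2 * \<rho> \<le> real N" using real_arch_simple by blast
  show "summable (\<lambda>M. of_real \<rho> ^ M * rGamma (\<theta> + of_nat M))"
  proof (rule summable_ratio_test[where c = "1 / 2" and N = N])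
    fix M assume "N \<le> M"
    then have M: "2 * \<rho> \<le> real M" using N by linarith
    have "real M \<le> norm (\<theta> + of_nat M)" using complex_Re_le_cmod[of "\<theta> + of_nat M"] assms by simp
    then have "\<rho> * 2 \<le> norm (\<theta> + of_nat M)" using M by simp
    then have "\<rho> * norm (rGamma (\<theta> + of_nat M + 1)) \<le> 1 / 2 * (norm (\<theta> + of_nat M) * norm (rGamma (\<theta> + of_nat M + 1)))"
      using mult_right_mono[of "\<rho> * 2" "norm (\<theta> + of_nat M)" "norm (rGamma (\<theta> + of_nat M + 1))"] by simp
    also have "norm (\<theta> + of_nat M) * norm (rGamma (\<theta> + of_nat M + 1)) = norm (rGamma (\<theta> + of_nat M))"
      by (simp only: norm_mult[symmetric] rGamma_plus1)
    finally have "\<rho> ^ M * (\<rho> * norm (rGamma (\<theta> + of_nat M + 1))) \<le> \<rho> ^ M * (1 / 2 * norm (rGamma (\<theta> + of_nat M)))"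
      using \<rho> by (intro mult_left_mono) auto
    then show "norm (of_real \<rho> ^ Suc M * rGamma (\<theta> + of_nat (Suc M))) \<le> 1 / 2 * norm (of_real \<rho> ^ M * rGamma (\<theta> + of_nat M))"
      using \<rho> by (simp add: norm_mult norm_power algebra_simps)
  qed simp
qed

lemma mm_laplace_reversible:
  "of_real \<rho> ^ i * fact n * mm_laplace i n \<theta> = of_real \<rho> ^ n * fact i * mm_laplace n i \<theta>"
proof -
  have eq: "\<rho> ^ i * fact n * mm_inf \<rho> x i n = \<rho> ^ n * fact i * mm_inf \<rho> x n i" for x
    using mm_inf_reversible[OF \<rho>, of i x n] by (simp add: field_simps)
  have *: "of_real \<rho> ^ i * fact n * mm_laplace i n \<theta> =
      (LINT t:{0..}|lborel. exp (- \<theta> * of_real t) * of_real (\<rho> ^ i * fact n * mm_inf \<rho> (exp (- t)) i n))" for i n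
    unfolding mm_laplace_def set_integral_mult_right[symmetric]
    by (rule set_lebesgue_integral_cong) (auto simp: mult_ac)
  show ?thesis unfolding * eq ..
qed

section \<open>Recurrences of \<open>G\<close> and the product formula\<close>

context
  fixes \<epsilon> :: real and g :: "real \<Rightarrow> complex"
  assumes g: "hankel_middle \<epsilon> g"
begin

lemma G_fun_hankel_kernel:
  "G_fun \<epsilon> g \<rho> n \<theta> = 1 / (2 * of_real pi * \<i>) * hankel_integral \<epsilon> g (hankel_kernel \<rho> (Suc n) \<theta>)"
  by (simp add: G_fun_def G_integrand_hankel_kernel)

text \<open>The sign of the \<theta> term is opposite to that in \<open>F_fun_Suc\<close>, because a
  power of z - 1 replaces one of 1 - z.\<close>

lemma G_fun_Suc:
  assumes "Re \<theta> > 0"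
  shows "of_nat (Suc n) * G_fun \<epsilon> g \<rho> (Suc n) \<theta> = of_real \<rho> * G_fun \<epsilon> g \<rho> n \<theta> - \<theta> * G_fun \<epsilon> g \<rho> n (\<theta> + 1)"
  using hankel_kernel_by_parts[OF \<rho> _ g, of \<theta> "Suc n"] assms
  unfolding G_fun_hankel_kernel by (simp add: field_simps del: of_nat_Suc)

lemma G_fun_shift:
  assumes "Re \<theta> > 0"
  shows "G_fun \<epsilon> g \<rho> n (\<theta> + 1) - G_fun \<epsilon> g \<rho> (Suc n) (\<theta> + 1) = G_fun \<epsilon> g \<rho> (Suc n) \<theta>"
  using hankel_kernel_shift[OF \<rho> _ g, of \<theta> "Suc n"] assms
  unfolding G_fun_hankel_kernel by (simp add: field_simps del: of_nat_Suc)

text \<open>By \<open>hankel_kernel_shift\<close> at \<open>m = 0\<close> the two terms combine into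
  the integral without a power of z, which Hankel's formula evaluates.\<close>

lemma G_fun_0_shift:
  assumes "Re \<theta> > 0"
  shows "G_fun \<epsilon> g \<rho> 0 \<theta> + G_fun \<epsilon> g \<rho> 0 (\<theta> + 1) = of_real (exp \<rho>) * of_real \<rho> powr \<theta> * rGamma (\<theta> + 1)"
proof -
  have "hankel_integral \<epsilon> g (hankel_kernel \<rho> 0 (\<theta> + 1)) =
      2 * of_real pi * \<i> * of_real (exp \<rho>) * of_real \<rho> powr \<theta> * rGamma (\<theta> + 1)"
    using hankel_kernel_0[OF \<rho> _ g, of "\<theta> + 1"] assms by simp
  then have "of_real (exp \<rho>) * of_real \<rho> powr \<theta> * rGamma (\<theta> + 1) =
      1 / (2 * of_real pi * \<i>) * hankel_integral \<epsilon> g (hankel_kernel \<rho> 0 (\<theta> + 1))"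
    by simp
  also have "\<dots> = G_fun \<epsilon> g \<rho> 0 \<theta> + G_fun \<epsilon> g \<rho> 0 (\<theta> + 1)"
    using hankel_kernel_shift[OF \<rho> _ g, of \<theta> 0] assms
    unfolding G_fun_hankel_kernel by (simp add: algebra_simps add_divide_distrib)
  finally show ?thesis ..
qed

text \<open>Both sides of the claim satisfy the same inhomogeneous difference equation in \<open>\<theta>\<close>, so their
  difference changes sign under \<open>\<theta> \<mapsto> \<theta> + 1\<close>; as it tends to 0 along \<open>\<theta> + M\<close>, it vanishes.\<close>

lemma G_fun_0_eq_laplace:
  assumes \<theta>: "Re \<theta> > 0"
  shows "G_fun \<epsilon> g \<rho> 0 \<theta> = of_real (exp \<rho>) * of_real \<rho> powr \<theta> * rGamma \<theta> * mm_laplace 0 0 \<theta>"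
proof -
  define D where "D \<theta> = of_real (exp \<rho>) * of_real \<rho> powr \<theta> * rGamma \<theta> * mm_laplace 0 0 \<theta> - G_fun \<epsilon> g \<rho> 0 \<theta>" for \<theta>
  have flip: "D (\<theta> + 1) = - D \<theta>" if \<theta>: "Re \<theta> > 0" for \<theta>
  proof -
    have "of_real (exp \<rho>) * of_real \<rho> powr \<theta> * rGamma \<theta> * mm_laplace 0 0 \<theta> +
        of_real (exp \<rho>) * of_real \<rho> powr (\<theta> + 1) * rGamma (\<theta> + 1) * mm_laplace 0 0 (\<theta> + 1) =
        of_real (exp \<rho>) * of_real \<rho> powr \<theta> * rGamma (\<theta> + 1) * (\<theta> * mm_laplace 0 0 \<theta> + of_real \<rho> * mm_laplace 0 0 (\<theta> + 1))"
      unfolding rGamma_plus1[of \<theta>, symmetric] using \<rho> by (simp add: powr_add algebra_simps)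
    also have "\<dots> = G_fun \<epsilon> g \<rho> 0 \<theta> + G_fun \<epsilon> g \<rho> 0 (\<theta> + 1)"
      unfolding mm_laplace_0_0[OF \<theta>] G_fun_0_shift[OF \<theta>] by simp
    finally show ?thesis unfolding D_def by (simp add: algebra_simps)
  qed
  have norm: "norm (D (\<theta> + of_nat M)) = norm (D \<theta>)" for M
  proof (induction M)
    case (Suc M)
    have "D (\<theta> + of_nat M + 1) = - D (\<theta> + of_nat M)" by (rule flip) (use \<theta> in simp)
    then show ?case using Suc by (simp add: add_ac)
  qed simp
  have "(\<lambda>M. mm_laplace 0 0 (\<theta> + of_nat M) * (of_real \<rho> ^ M * rGamma (\<theta> + of_nat M))) \<longlonglongrightarrow> 0"
  proof (rule Lim_null_comparison)
    let ?K = "LINT t:{0..}|lborel. exp (- Re \<theta> * t)"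
    show "(\<lambda>M. ?K * norm (of_real \<rho> ^ M * rGamma (\<theta> + of_nat M))) \<longlonglongrightarrow> 0"
      by (intro tendsto_mult_right_zero tendsto_norm_zero rGamma_mult_power_tendsto_0 \<theta>)
    show "\<forall>\<^sub>F M in sequentially. norm (mm_laplace 0 0 (\<theta> + of_nat M) * (of_real \<rho> ^ M * rGamma (\<theta> + of_nat M)))
        \<le> ?K * norm (of_real \<rho> ^ M * rGamma (\<theta> + of_nat M))"
      unfolding norm_mult[of "mm_laplace _ _ _"]
      by (intro always_eventually allI mult_right_mono mm_laplace_bound \<theta>) auto
  qed
  then have "(\<lambda>M. of_real (exp \<rho>) * of_real \<rho> powr \<theta> * (mm_laplace 0 0 (\<theta> + of_nat M) * (of_real \<rho> ^ M * rGamma (\<theta> + of_nat M)))) \<longlonglongrightarrow> 0"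
    by (rule tendsto_mult_right_zero)
  moreover have "(\<lambda>M. G_fun \<epsilon> g \<rho> 0 (\<theta> + of_nat M)) \<longlonglongrightarrow> 0"
    unfolding G_fun_hankel_kernel by (rule tendsto_mult_right_zero) (use hankel_kernel_decay[OF _ g] \<theta> in auto)
  ultimately have "(\<lambda>M. of_real (exp \<rho>) * of_real \<rho> powr \<theta> * (mm_laplace 0 0 (\<theta> + of_nat M) * (of_real \<rho> ^ M * rGamma (\<theta> + of_nat M)))
      - G_fun \<epsilon> g \<rho> 0 (\<theta> + of_nat M)) \<longlonglongrightarrow> 0 - 0"
    by (rule tendsto_diff)
  moreover have "of_real (exp \<rho>) * of_real \<rho> powr \<theta> * (mm_laplace 0 0 (\<theta> + of_nat M) * (of_real \<rho> ^ M * rGamma (\<theta> + of_nat M)))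
      - G_fun \<epsilon> g \<rho> 0 (\<theta> + of_nat M) = D (\<theta> + of_nat M)" for M
    unfolding D_def using \<rho> by (simp add: powr_add powr_nat' mult_ac)
  ultimately have "(\<lambda>M. D (\<theta> + of_nat M)) \<longlonglongrightarrow> 0" by simp
  then have "(\<lambda>M. norm (D (\<theta> + of_nat M))) \<longlonglongrightarrow> 0" by (rule tendsto_norm_zero)
  then have "D \<theta> = 0" unfolding norm by (simp add: LIMSEQ_const_iff)
  then show ?thesis by (simp add: D_def)
qed

lemma mm_laplace_0_eq:
  assumes "Re \<theta> > 0"
  shows "mm_laplace 0 n \<theta> = Gamma \<theta> * of_real (exp (- \<rho>)) * of_real \<rho> powr (- \<theta>) * G_fun \<epsilon> g \<rho> n \<theta>"
  using assms
proof (induction n arbitrary: \<theta>)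
  case 0
  have "\<theta> \<notin> \<int>\<^sub>\<le>\<^sub>0" using 0 by (auto elim!: nonpos_Ints_cases)
  then have "Gamma \<theta> * rGamma \<theta> = 1" by (simp add: Gamma_def rGamma_eq_zero_iff)
  moreover have "complex_of_real (exp (- \<rho>)) * of_real (exp \<rho>) = 1"
    by (simp flip: of_real_mult exp_add)
  moreover have "of_real \<rho> powr (- \<theta>) * of_real \<rho> powr \<theta> = 1"
    using \<rho> by (simp flip: powr_add)
  moreover have "x * u * v * (u' * v' * x' * y) = y"
    if "x * x' = 1" "u * u' = 1" "v * v' = 1" for x u v u' v' x' y :: complex
  proof -
    have "x * u * v * (u' * v' * x' * y) = (x * x') * (u * u') * (v * v') * y" by (simp only: mult_ac)
    then show ?thesis unfolding that by simp
  qed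
  ultimately show ?case unfolding G_fun_0_eq_laplace[OF 0] by simp
next
  case (Suc n)
  have \<theta>1: "Re (\<theta> + 1) > 0" "\<theta> \<notin> \<int>\<^sub>\<le>\<^sub>0" using Suc.prems by (auto elim!: nonpos_Ints_cases)
  \<comment> \<open>A unit shift of \<theta> multiplies the prefactor by \<theta>/\<rho>; this
    matches \<open>mm_laplace_0_Suc\<close> with \<open>G_fun_Suc\<close>.\<close>
  have K: "of_real \<rho> * (Gamma (\<theta> + 1) * of_real (exp (- \<rho>)) * of_real \<rho> powr (- (\<theta> + 1))) =
      \<theta> * (Gamma \<theta> * of_real (exp (- \<rho>)) * of_real \<rho> powr (- \<theta>))"
    using \<rho> Gamma_plus1[OF \<theta>1(2)] powr_add[of "of_real \<rho>" "- \<theta>" "- 1"] by (simp add: powr_minus field_simps)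
  have alg: "p * (a * x - b * y) = a * (p * x - t * y)" if "p * b = t * a" for p a b x y t :: complex
    using that by algebra
  have "of_nat (Suc n) * mm_laplace 0 (Suc n) \<theta> =
      Gamma \<theta> * of_real (exp (- \<rho>)) * of_real \<rho> powr (- \<theta>) * (of_real \<rho> * G_fun \<epsilon> g \<rho> n \<theta> - \<theta> * G_fun \<epsilon> g \<rho> n (\<theta> + 1))"
    unfolding mm_laplace_0_Suc[OF Suc.prems] Suc.IH[OF Suc.prems] Suc.IH[OF \<theta>1(1)] by (rule alg[OF K])
  also have "\<dots> = of_nat (Suc n) * (Gamma \<theta> * of_real (exp (- \<rho>)) * of_real \<rho> powr (- \<theta>) * G_fun \<epsilon> g \<rho> (Suc n) \<theta>)"
    unfolding G_fun_Suc[OF Suc.prems, symmetric] by simp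
  finally show ?case by (simp del: of_nat_Suc)
qed

context
  fixes r :: real
  assumes r: "0 < r" "r < 1"
begin

text \<open>Induction on \<open>i\<close> with \<theta> free. \<open>G_fun_shift\<close> merges the
  two values of G at \<theta> + 1 into the G at \<theta> already present, which factors out;
  \<open>F_fun_Suc\<close> then combines the F factors. The hypothesis \<open>i \<le> n\<close>
  keeps all three instances of the induction hypothesis in range.\<close>

lemma mm_laplace_le_eq:
  assumes "i \<le> n" "Re \<theta> > 0"
  shows "of_real \<rho> ^ i * mm_laplace i n \<theta> =
    fact i * (Gamma \<theta> * of_real (exp (- \<rho>)) * of_real \<rho> powr (- \<theta>)) * F_fun r \<rho> i \<theta> * G_fun \<epsilon> g \<rho> n \<theta>"
  using assms
proof (induction i arbitrary: n \<theta>)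
  case 0
  then show ?case by (simp add: mm_laplace_0_eq F_fun_0[OF r])
next
  case (Suc i)
  then obtain m where m: "n = Suc m" "i \<le> m" by (cases n) auto
  have \<theta>: "Re \<theta> > 0" "Re (\<theta> + 1) > 0" "\<theta> \<notin> \<int>\<^sub>\<le>\<^sub>0" using Suc.prems by (auto elim!: nonpos_Ints_cases)
  define K where "K \<theta> = Gamma \<theta> * of_real (exp (- \<rho>)) * of_real \<rho> powr (- \<theta>)" for \<theta> :: complex
  have K: "of_real \<rho> * K (\<theta> + 1) = \<theta> * K \<theta>"
    unfolding K_def
    using \<rho> Gamma_plus1[OF \<theta>(3)] powr_add[of "of_real \<rho>" "- \<theta>" "- 1"] by (simp add: powr_minus field_simps)
  have IH: "of_real \<rho> ^ i * mm_laplace i n \<eta> = fact i * K \<eta> * F_fun r \<rho> i \<eta> * G_fun \<epsilon> g \<rho> n \<eta>"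
    if "i \<le> n" "Re \<eta> > 0" for n \<eta>
    using Suc.IH[OF that] by (simp add: K_def)
  note IHs = IH[of "Suc m" \<theta>] IH[of "Suc m" "\<theta> + 1"] IH[of m "\<theta> + 1"]
  have "of_real \<rho> ^ Suc i * mm_laplace (Suc i) n \<theta> =
     of_real \<rho> * (of_real \<rho> ^ i * mm_laplace i (Suc m) \<theta> - of_real \<rho> ^ i * mm_laplace i (Suc m) (\<theta> + 1)
      + of_real \<rho> ^ i * mm_laplace i m (\<theta> + 1))"
    unfolding m(1) mm_laplace_Suc_Suc[OF \<theta>(1)] by (simp add: algebra_simps)
  also have "\<dots> = of_real \<rho> * (fact i * K \<theta> * F_fun r \<rho> i \<theta> * G_fun \<epsilon> g \<rho> (Suc m) \<theta>
      + fact i * K (\<theta> + 1) * F_fun r \<rho> i (\<theta> + 1) * (G_fun \<epsilon> g \<rho> m (\<theta> + 1) - G_fun \<epsilon> g \<rho> (Suc m) (\<theta> + 1)))"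
    using IHs m \<theta> by (simp add: algebra_simps)
  also have "\<dots> = fact i * G_fun \<epsilon> g \<rho> (Suc m) \<theta> *
      (of_real \<rho> * K \<theta> * F_fun r \<rho> i \<theta> + (of_real \<rho> * K (\<theta> + 1)) * F_fun r \<rho> i (\<theta> + 1))"
    unfolding G_fun_shift[OF \<theta>(1)] by (simp add: algebra_simps)
  also have "\<dots> = fact i * G_fun \<epsilon> g \<rho> (Suc m) \<theta> * K \<theta> *
      (of_real \<rho> * F_fun r \<rho> i \<theta> + \<theta> * F_fun r \<rho> i (\<theta> + 1))"
    unfolding K by (simp add: algebra_simps)
  also have "\<dots> = fact (Suc i) * K \<theta> * F_fun r \<rho> (Suc i) \<theta> * G_fun \<epsilon> g \<rho> n \<theta>"
    unfolding F_fun_Suc[OF r, symmetric] m(1) by (simp add: mult_ac)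
  finally show ?case by (simp add: K_def)
qed

text \<open>For \<open>n < i\<close> the two states are exchanged by
  \<open>mm_laplace_reversible\<close>.\<close>

lemma mm_laplace_eq:
  assumes \<theta>: "Re \<theta> > 0"
  shows "mm_laplace i n \<theta> =
    Gamma \<theta> * fact i * of_real (exp (- \<rho>)) / of_real \<rho> powr (of_nat i + \<theta>) *
    (if n \<ge> i then F_fun r \<rho> i \<theta> * G_fun \<epsilon> g \<rho> n \<theta> else G_fun \<epsilon> g \<rho> i \<theta> * F_fun r \<rho> n \<theta>)"
proof -
  have powr: "of_real \<rho> powr (of_nat i + \<theta>) = of_real \<rho> ^ i * of_real \<rho> powr \<theta>"
    using \<rho> by (simp add: powr_add powr_nat')
  show ?thesis
  proof (cases "i \<le> n")
    case True
    show ?thesis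
      using mm_laplace_le_eq[OF True \<theta>] \<rho> True unfolding powr by (simp add: powr_minus field_simps)
  next
    case False
    then have "of_real \<rho> ^ n * mm_laplace n i \<theta> =
      fact n * (Gamma \<theta> * of_real (exp (- \<rho>)) * of_real \<rho> powr (- \<theta>)) * F_fun r \<rho> n \<theta> * G_fun \<epsilon> g \<rho> i \<theta>"
      by (intro mm_laplace_le_eq \<theta>) auto
    moreover have "fact n * (of_real \<rho> ^ i * mm_laplace i n \<theta>) = fact i * (of_real \<rho> ^ n * mm_laplace n i \<theta>)"
      using mm_laplace_reversible[of i n \<theta>] by (simp add: mult_ac)
    ultimately have "fact n * (of_real \<rho> ^ i * mm_laplace i n \<theta>) = fact n * (fact i *
      (Gamma \<theta> * of_real (exp (- \<rho>)) * of_real \<rho> powr (- \<theta>) * F_fun r \<rho> n \<theta> * G_fun \<epsilon> g \<rho> i \<theta>))"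
      by (simp add: mult_ac)
    then have "of_real \<rho> ^ i * mm_laplace i n \<theta> = fact i *
      (Gamma \<theta> * of_real (exp (- \<rho>)) * of_real \<rho> powr (- \<theta>) * F_fun r \<rho> n \<theta> * G_fun \<epsilon> g \<rho> i \<theta>)"
      by simp
    then show ?thesis using \<rho> False unfolding powr by (simp add: powr_minus field_simps)
  qed
qed

end
end
end

theorem corollary2:
  fixes \<rho> r \<epsilon> :: real
    and n0 :: nat
    and g :: "real \<Rightarrow> complex"
    and M :: "'w measure"
    and N :: "real \<Rightarrow> 'w \<Rightarrow> nat"
  assumes rho: "\<rho> > 0"
    and process: "birth_death_process M N (\<lambda>_. \<rho>) (\<lambda>n. real n)"
    and initial: "AE \<omega> in M. N 0 \<omega> = n0"
    and C0: "0 < r" "r < 1"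
    and C1: "hankel_middle \<epsilon> g"
  shows
    "(\<forall>n \<theta>. Re \<theta> > 0 \<longrightarrow>
        set_integrable lborel {0..}
          (\<lambda>t. exp (- \<theta> * of_real t) * of_real (trans_prob M N n0 n t)) \<and>
        (LINT t:{0..}|lborel. exp (- \<theta> * of_real t) * of_real (trans_prob M N n0 n t)) =
          Gamma \<theta> * fact n0 * of_real (exp (- \<rho>)) / of_real \<rho> powr (of_nat n0 + \<theta>) *
          (if n \<ge> n0 then F_fun r \<rho> n0 \<theta> * G_fun \<epsilon> g \<rho> n \<theta>
           else G_fun \<epsilon> g \<rho> n0 \<theta> * F_fun r \<rho> n \<theta>)) \<and>
     (\<forall>n. \<forall>t\<ge>0.
        summable (\<lambda>k. complex_of_real (\<rho> ^ k / fact k * exp (- real k * t)) *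
                      F_fun r \<rho> n0 (- of_nat k) * F_fun r \<rho> n (- of_nat k)) \<and>
        complex_of_real (trans_prob M N n0 n t) =
          of_real (fact n0 * exp (- \<rho>) / \<rho> ^ n0) *
          (\<Sum>k. complex_of_real (\<rho> ^ k / fact k * exp (- real k * t)) *
               F_fun r \<rho> n0 (- of_nat k) * F_fun r \<rho> n (- of_nat k))) \<and>
     (\<forall>n k.
        F_fun r \<rho> n (- of_nat k) =
          1 / (2 * of_real pi * \<i>) *
          contour_integral (circlepath 0 r)
            (\<lambda>z. (1 - z) ^ k / z ^ (n + 1) * exp (of_real \<rho> * z)) \<and>
        F_fun r \<rho> n (- of_nat k) =
          of_real (\<Sum>j = 0..min k n. real (k choose j) * (- 1) ^ j * \<rho> ^ (n - j) / fact (n - j))) \<and>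
     (\<forall>n. \<forall>t>0.
        trans_prob M N n0 n t =
          \<rho> ^ n * (1 - exp (- t)) ^ n * exp (- \<rho> * (1 - exp (- t))) *
          (\<Sum>j = 0..min n n0. real (n0 choose j) * \<rho> powi (- int j) * exp (- real j * t) *
               (1 - exp (- t)) powi (int n0 - 2 * int j) * (1 / fact (n - j)))) \<and>
     (\<forall>n. ((\<lambda>t. trans_prob M N n0 n t) \<longlongrightarrow> exp (- \<rho>) * \<rho> ^ n / fact n) at_top)"
proof (intro conjI allI impI)
  have p: "trans_prob M N n0 n t = mm_inf \<rho> (exp (- t)) n0 n" if "t \<ge> 0" for n t
    by (rule trans_prob_eq_mm_inf[OF rho process initial that])
  {
    fix n and \<theta> :: complex assume \<theta>: "Re \<theta> > 0"
    have "set_integrable lborel {0..} (\<lambda>t. exp (- \<theta> * of_real t) * of_real (trans_prob M N n0 n t)) =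
        set_integrable lborel {0..} (\<lambda>t. exp (- \<theta> * of_real t) * of_real (mm_inf \<rho> (exp (- t)) n0 n))"
      by (rule set_integrable_cong) (auto simp: p)
    then show "set_integrable lborel {0..} (\<lambda>t. exp (- \<theta> * of_real t) * of_real (trans_prob M N n0 n t))"
      using mm_laplace_integrable[OF rho \<theta>, of n0 n] by blast
    have "(LINT t:{0..}|lborel. exp (- \<theta> * of_real t) * of_real (trans_prob M N n0 n t)) = mm_laplace \<rho> n0 n \<theta>"
      unfolding mm_laplace_def[OF rho] by (rule set_lebesgue_integral_cong) (auto simp: p)
    then show "(LINT t:{0..}|lborel. exp (- \<theta> * of_real t) * of_real (trans_prob M N n0 n t)) =
        Gamma \<theta> * fact n0 * of_real (exp (- \<rho>)) / of_real \<rho> powr (of_nat n0 + \<theta>) *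
        (if n \<ge> n0 then F_fun r \<rho> n0 \<theta> * G_fun \<epsilon> g \<rho> n \<theta>
         else G_fun \<epsilon> g \<rho> n0 \<theta> * F_fun r \<rho> n \<theta>)"
      by (simp only: mm_laplace_eq[OF rho C1 C0 \<theta>])
  next
    fix n and t :: real assume t: "t \<ge> 0"
    define s where "s = mm_inf \<rho> (exp (- t)) n0 n * \<rho> ^ n0 * exp \<rho> / fact n0"
    have pw: "(\<rho> * exp (- t)) ^ k = \<rho> ^ k * exp (- real k * t)" for k
      by (simp add: power_mult_distrib exp_of_nat_mult[symmetric])
    have "(\<lambda>k. complex_of_real ((\<rho> * exp (- t)) ^ k / fact k * charlier \<rho> n0 k * charlier \<rho> n k)) sums of_real s"
      unfolding s_def by (intro sums_of_real mm_inf_spectral rho)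
    then have sums: "(\<lambda>k. complex_of_real (\<rho> ^ k / fact k * exp (- real k * t)) *
        F_fun r \<rho> n0 (- of_nat k) * F_fun r \<rho> n (- of_nat k)) sums of_real s"
      unfolding F_fun_neg_nat[OF C0] pw by (simp add: mult_ac)
    then show "summable (\<lambda>k. complex_of_real (\<rho> ^ k / fact k * exp (- real k * t)) *
        F_fun r \<rho> n0 (- of_nat k) * F_fun r \<rho> n (- of_nat k))"
      by (rule sums_summable)
    have "fact n0 * exp (- \<rho>) / \<rho> ^ n0 * s = mm_inf \<rho> (exp (- t)) n0 n"
      using rho by (simp add: s_def exp_minus)
    then show "complex_of_real (trans_prob M N n0 n t) = of_real (fact n0 * exp (- \<rho>) / \<rho> ^ n0) *
        (\<Sum>k. complex_of_real (\<rho> ^ k / fact k * exp (- real k * t)) *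
               F_fun r \<rho> n0 (- of_nat k) * F_fun r \<rho> n (- of_nat k))"
      unfolding sums_unique[OF sums, symmetric] p[OF t] of_real_mult[symmetric] by simp
  next
    fix n k
    show "F_fun r \<rho> n (- of_nat k) = 1 / (2 * of_real pi * \<i>) *
        contour_integral (circlepath 0 r) (\<lambda>z. (1 - z) ^ k / z ^ (n + 1) * exp (of_real \<rho> * z))"
      by (rule F_fun_neg_nat_integral[OF C0])
    show "F_fun r \<rho> n (- of_nat k) =
        of_real (\<Sum>j = 0..min k n. real (k choose j) * (- 1) ^ j * \<rho> ^ (n - j) / fact (n - j))"
      unfolding F_fun_neg_nat[OF C0] charlier_eq_sum_min ..
  next
    fix n and t :: real assume t: "t > 0"
    have pw: "exp (- t) ^ j = exp (- real j * t)" for j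
      by (simp add: exp_of_nat_mult[symmetric])
    have lt: "exp (- t) < 1" using t by simp
    show "trans_prob M N n0 n t =
        \<rho> ^ n * (1 - exp (- t)) ^ n * exp (- \<rho> * (1 - exp (- t))) *
        (\<Sum>j = 0..min n n0. real (n0 choose j) * \<rho> powi (- int j) * exp (- real j * t) *
             (1 - exp (- t)) powi (int n0 - 2 * int j) * (1 / fact (n - j)))"
      unfolding p[OF less_imp_le[OF t]] mm_inf_sum_powi[OF rho exp_gt_zero lt] pw ..
  next
    fix n
    \<comment> \<open>The limit is the value at x = 0, by continuity in x = exp(-t).\<close>
    have "continuous_on UNIV (\<lambda>x. mm_inf \<rho> x n0 n)"
      by (intro continuous_intros)
    then have "isCont (\<lambda>x. mm_inf \<rho> x n0 n) 0"
      by (simp add: continuous_on_eq_continuous_at)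
    moreover have "((\<lambda>t. exp (- t)) \<longlongrightarrow> (0::real)) at_top" by real_asymp
    ultimately have "((\<lambda>t. mm_inf \<rho> (exp (- t)) n0 n) \<longlongrightarrow> mm_inf \<rho> 0 n0 n) at_top"
      by (rule isCont_tendsto_compose)
    then have "((\<lambda>t. mm_inf \<rho> (exp (- t)) n0 n) \<longlongrightarrow> exp (- \<rho>) * \<rho> ^ n / fact n) at_top"
      by (simp only: mm_inf_0)
    then show "((\<lambda>t. trans_prob M N n0 n t) \<longlongrightarrow> exp (- \<rho>) * \<rho> ^ n / fact n) at_top"
      by (rule Lim_transform_eventually)
        (use p in \<open>auto intro!: eventually_mono[OF eventually_ge_at_top[of 0]]\<close>)
  }
qed

end
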